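(* Let $t_0\ge 0$, let $a,g,h:[0,\infty)\to\mathbb R$ be Lebesgue measurable functions, let $K(t,s)\ge0$ be a Lebesgue measurable locally integrable function on $[0,\infty)\times[0,\infty)$, and put $b(t):=\int_{h(t)}^t K(t,s)\,ds$. Suppose that $a,b$ are essentially bounded on $[0,\infty)$; $|a(t)|\le a_0$ for $t\ge t_0$ with a constant $a_0<1$; $b(t)\ge\beta>0$ for $t\ge t_0$ with a constant $\beta$; $g(t)\le t$, $h(t)\le t$, $\lim_{t\to\infty}g(t)=\lim_{t\to\infty}h(t)=\infty$; the set $g^{-1}(E)$ has Lebesgue measure zero whenever $E\subset\mathbb R$ has Lebesgue measure zero; and $t-g(t)\le\delta$, $t-h(t)\le\tau$ for $t\ge t_0$ with constants $\delta>0$, $\tau>0$. Assume that at least one of the following conditions holds: (i) $\displaystyle\int_{h(t)}^t b(s)\,ds\le\frac1e$ for $t\ge t_0$, and $\displaystyle\|a\|_{[t_0,\infty)}+\|b\|_{[t_0,\infty)}\left\|\frac ab\right\|_{[t_0,\infty)}<1$; (ii) $\displaystyle\left\|\frac{a}{b_0}\right\|_{[t_0,\infty)}\frac{\|b\|_{[t_0,\infty)}}{1-\|a\|_{[t_0,\infty)}}+\left\|\frac{b-b_0}{b_0}\right\|_{[t_0,\infty)}<1$, where $b_0(t)=\min\left\{b(t),\frac1{\tau e}\right\}$; (iii) $\displaystyle\|b\|_{[t_0,\infty)}\left(\left\|\frac ab\right\|_{[t_0,\infty)}+\left\|\left(t-h(t)-\frac1{\|b\|_{[t_0,\infty)}e}\right)^+\right\|_{[t_0,\infty)}\right)<1-\|a\|_{[t_0,\infty)}$.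 Then the equation $$\dot x(t)-a(t)\dot x(g(t))+\int_{h(t)}^t K(t,s)x(s)\,ds=0$$ is exponentially stable.
   Context: Notation: $\|f\|_{[t_0,\infty)}=\operatorname{ess\,sup}_{t\ge t_0}|f(t)|$ (an expression in $t$ inside the norm denotes the corresponding function of $t$); $u^+=\max\{u,0\}$. Conventions: $K(t,s)=0$ for $s<0$, and $b$ is taken to be $0$ at negative arguments. Solutions: for an initial point $\sigma\ge t_0$ and bounded Borel measurable functions $\varphi:(-\infty,\sigma]\to\mathbb R$, $\psi:(-\infty,\sigma)\to\mathbb R$ (prescribed independently of each other), a solution of the equation with initial conditions $x(t)=\varphi(t)$ for $t\le\sigma$, $\dot x(t)=\psi(t)$ for $t<\sigma$ is a function $x$ that is absolutely continuous on each $[\sigma,c]$, has locally essentially bounded derivative on $[\sigma,\infty)$, and satisfies the equation for almost all $t\ge\sigma$, where $x$ at arguments $\le\sigma$ is replaced by $\varphi$ and $\dot x$ at arguments $<\sigma$ is replaced by $\psi$. The equation is (uniformly) exponentially stable if there exist $M>0$, $\gamma>0$, not depending on $\sigma\ge t_0$, $\varphi$, $\psi$, such that every such solution satisfies $|x(t)|\le M e^{-\gamma(t-\sigma)}\sup_{s\le\sigma}(|\varphi(s)|+|\psi(s)|)$ for $t\ge\sigma$ (with $\psi(\sigma):=0$). *)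

theory Defs
  imports "HOL-Analysis.Analysis" "HOL-Probability.Essential_Supremum"
begin

(* esssup is infinity for non-measurable functions, so "ess_norm t0 f < \<infinity>" says that f is
   Lebesgue measurable and essentially bounded on [t0,\<infinity>). *)
definition ess_norm :: "real \<Rightarrow> (real \<Rightarrow> real) \<Rightarrow> ereal" where
  "ess_norm t0 f = esssup (lebesgue_on {t0..}) (\<lambda>t. ereal \<bar>f t\<bar>)"

(* The convention K(t,s) = 0 for s < 0. *)
definition kernel_ext :: "(real \<Rightarrow> real \<Rightarrow> real) \<Rightarrow> real \<Rightarrow> real \<Rightarrow> real" where
  "kernel_ext K t s = (if s < 0 then 0 else K t s)"

(* b(t), set to 0 at negative arguments.  Integrals are with respect to the completed measure
   lebesgue because K is only Lebesgue measurable. *)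
definition kernel_mass :: "(real \<Rightarrow> real \<Rightarrow> real) \<Rightarrow> (real \<Rightarrow> real) \<Rightarrow> real \<Rightarrow> real" where
  "kernel_mass K h t =
     (if t < 0 then 0 else (LINT s:{h t..t}|lebesgue. kernel_ext K t s))"

definition absolutely_continuous_fun_on :: "real \<Rightarrow> real \<Rightarrow> (real \<Rightarrow> real) \<Rightarrow> bool" where
  "absolutely_continuous_fun_on p q f \<longleftrightarrow>
     (\<forall>\<epsilon>>0. \<exists>\<eta>>0. \<forall>(n::nat) (u::nat \<Rightarrow> real) (v::nat \<Rightarrow> real).
        (\<forall>i<n. p \<le> u i \<and> u i \<le> v i \<and> v i \<le> q) \<longrightarrow>
        disjoint_family_on (\<lambda>i. {u i<..<v i}) {..<n} \<longrightarrow>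
        (\<Sum>i<n. v i - u i) < \<eta> \<longrightarrow>
        (\<Sum>i<n. \<bar>f (v i) - f (u i)\<bar>) < \<epsilon>)"

(* The derivative of x on [\<sigma>,\<infinity>) (one-sided at \<sigma>), replaced by \<psi> before \<sigma>.  Where x is not
   differentiable the value is unspecified; for a solution this is a null set of arguments. *)
definition deriv_hist :: "real \<Rightarrow> (real \<Rightarrow> real) \<Rightarrow> (real \<Rightarrow> real) \<Rightarrow> real \<Rightarrow> real" where
  "deriv_hist \<sigma> \<psi> x t = (if t < \<sigma> then \<psi> t else vector_derivative x (at t within {\<sigma>..}))"

definition initial_data :: "real \<Rightarrow> (real \<Rightarrow> real) \<Rightarrow> (real \<Rightarrow> real) \<Rightarrow> bool" where
  "initial_data \<sigma> \<phi> \<psi> \<longleftrightarrow>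
     \<phi> \<in> borel_measurable (restrict_space borel {..\<sigma>}) \<and> bounded (\<phi> ` {..\<sigma>}) \<and>
     \<psi> \<in> borel_measurable (restrict_space borel {..<\<sigma>}) \<and> bounded (\<psi> ` {..<\<sigma>})"

(* x is taken to be a function on the whole line that equals \<phi> up to \<sigma>, so that x itself is
   the function whose values at arguments \<le> \<sigma> are replaced by \<phi>. *)
definition neutral_solution ::
  "(real \<Rightarrow> real) \<Rightarrow> (real \<Rightarrow> real) \<Rightarrow> (real \<Rightarrow> real) \<Rightarrow> (real \<Rightarrow> real \<Rightarrow> real) \<Rightarrow>
   real \<Rightarrow> (real \<Rightarrow> real) \<Rightarrow> (real \<Rightarrow> real) \<Rightarrow> (real \<Rightarrow> real) \<Rightarrow> bool" where
  "neutral_solution a g h K \<sigma> \<phi> \<psi> x \<longleftrightarrow>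
     (\<forall>t\<le>\<sigma>. x t = \<phi> t) \<and>
     (\<forall>c\<ge>\<sigma>. absolutely_continuous_fun_on \<sigma> c x) \<and>
     (\<forall>c\<ge>\<sigma>. \<exists>C. AE t in lebesgue_on {\<sigma>..c}.
        x differentiable (at t within {\<sigma>..}) \<and>
        \<bar>vector_derivative x (at t within {\<sigma>..})\<bar> \<le> C) \<and>
     (AE t in lebesgue_on {\<sigma>..}.
        deriv_hist \<sigma> \<psi> x t - a t * deriv_hist \<sigma> \<psi> x (g t)
          + (LINT s:{h t..t}|lebesgue. kernel_ext K t s * x s) = 0)"

definition exponentially_stable ::
  "real \<Rightarrow> (real \<Rightarrow> real) \<Rightarrow> (real \<Rightarrow> real) \<Rightarrow> (real \<Rightarrow> real) \<Rightarrow> (real \<Rightarrow> real \<Rightarrow> real) \<Rightarrow> bool" where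
  "exponentially_stable t0 a g h K \<longleftrightarrow>
     (\<exists>M>0. \<exists>\<gamma>>0. \<forall>\<sigma>\<ge>t0. \<forall>\<phi> \<psi> x.
        initial_data \<sigma> \<phi> \<psi> \<longrightarrow> neutral_solution a g h K \<sigma> \<phi> \<psi> x \<longrightarrow>
        (\<forall>t\<ge>\<sigma>. \<bar>x t\<bar> \<le> M * exp (- \<gamma> * (t - \<sigma>)) *
           (SUP s\<in>{..\<sigma>}. \<bar>\<phi> s\<bar> + \<bar>if s < \<sigma> then \<psi> s else 0\<bar>)))"

end

(* A mean value form of the distributed delay turns the equation into
   x'(t) + B(t) S(t) = f(t) with S(t) between the extreme values of x on [h0(t),t] and
   int_{h0(t)}^t B <= 1/e. Comparison with exp(-e int B) gives positivity for such equations, hence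
   |x| is bounded by the essential supremum of |f/B|, up to the history and with an exponential
   weight. Here f consists of a(t) x'(g(t)) and of the error of replacing the original delay term,
   both estimated by the weighted bounds of x and x'. The equation itself bounds x' by x, and each
   of the three conditions makes the resulting estimate of x by itself a contraction for a small
   exponent in the weight. Conditions (i) and (ii) use h0 = h with B = b and B = b0; condition (iii)
   uses B = b with the delay truncated at 1/(||b|| e). *)
theory Submission
  imports Defs
begin

text \<open>Why 1/e: if int B over one delay is at most k, then exp(-c int B) changes over that
  delay by a factor of at most exp(c k), and it passes the comparison when exp(c k) \<le> c. Such a
  c exists exactly for k \<le> 1/e, and for k = 1/e only c = e remains. The comparison needs a
  function that is nowhere larger before \<sigma> than at \<sigma>, while the history is arbitrary;
  therefore the barrier is lowered before \<sigma> by a multiple of the size of the history. All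
  estimates are made on a finite interval [\<sigma>, T], where the best weighted bounds of x and x'
  are finite to begin with; the resulting constant contains neither T nor an a priori bound of x'. A
  weight with exponent \<gamma> costs a factor exp(\<gamma> \<Delta>) per delay and \<beta>1 /
  (\<beta>1 - \<gamma>) in the comparison. Both tend to 1 as \<gamma> tends to 0, so strict
  inequalities leave room for some \<gamma> > 0.\<close>

section \<open>Absolute continuity and the fundamental theorem of calculus\<close>

text \<open>Arbitrary finite index sets allow the members of a tagged division to serve directly as
  indices.\<close>

lemma absolutely_continuous_fun_onD:
  assumes "absolutely_continuous_fun_on p q f" "\<epsilon> > 0"
  shows "\<exists>\<eta>>0. \<forall>I (u::'i \<Rightarrow> real) v. finite I \<longrightarrow> (\<forall>i\<in>I. p \<le> u i \<and> u i \<le> v i \<and> v i \<le> q) \<longrightarrow>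
      disjoint_family_on (\<lambda>i. {u i<..<v i}) I \<longrightarrow> (\<Sum>i\<in>I. v i - u i) < \<eta> \<longrightarrow>
      (\<Sum>i\<in>I. \<bar>f (v i) - f (u i)\<bar>) < \<epsilon>"
proof -
  obtain \<eta> where \<eta>: "\<eta> > 0" and H: "\<And>(n::nat) (u::nat \<Rightarrow> real) v.
        (\<forall>i<n. p \<le> u i \<and> u i \<le> v i \<and> v i \<le> q) \<Longrightarrow>
        disjoint_family_on (\<lambda>i. {u i<..<v i}) {..<n} \<Longrightarrow>
        (\<Sum>i<n. v i - u i) < \<eta> \<Longrightarrow> (\<Sum>i<n. \<bar>f (v i) - f (u i)\<bar>) < \<epsilon>"
    using assms unfolding absolutely_continuous_fun_on_def by meson
  show ?thesis
  proof (intro exI[of _ \<eta>] conjI \<eta> allI impI)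
    fix I and u v :: "'i \<Rightarrow> real"
    assume I: "finite I" and b: "\<forall>i\<in>I. p \<le> u i \<and> u i \<le> v i \<and> v i \<le> q"
      and d: "disjoint_family_on (\<lambda>i. {u i<..<v i}) I" and s: "(\<Sum>i\<in>I. v i - u i) < \<eta>"
    obtain k where k: "bij_betw k {..<card I} I"
      using ex_bij_betw_nat_finite[OF I] by (auto simp: atLeast0LessThan)
    have "(\<Sum>i<card I. \<bar>f (v (k i)) - f (u (k i))\<bar>) < \<epsilon>"
    proof (rule H)
      show "\<forall>i<card I. p \<le> u (k i) \<and> u (k i) \<le> v (k i) \<and> v (k i) \<le> q"
        using b bij_betwE[OF k] by auto
      show "disjoint_family_on (\<lambda>i. {u (k i)<..<v (k i)}) {..<card I}"
        unfolding disjoint_family_on_def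
      proof (intro ballI impI)
        fix i j assume "i \<in> {..<card I}" "j \<in> {..<card I}" "i \<noteq> j"
        then have "k i \<in> I" "k j \<in> I" "k i \<noteq> k j"
          using k by (auto simp: bij_betw_def inj_on_def)
        then show "{u (k i)<..<v (k i)} \<inter> {u (k j)<..<v (k j)} = {}"
          using d by (simp add: disjoint_family_on_def)
      qed
      show "(\<Sum>i<card I. v (k i) - u (k i)) < \<eta>"
        using s sum.reindex_bij_betw[OF k, of "\<lambda>i. v i - u i"] by simp
    qed
    then show "(\<Sum>i\<in>I. \<bar>f (v i) - f (u i)\<bar>) < \<epsilon>"
      using sum.reindex_bij_betw[OF k, of "\<lambda>i. \<bar>f (v i) - f (u i)\<bar>"] by simp
  qed
qed

lemma absolutely_continuous_fun_on_subset:
  assumes "absolutely_continuous_fun_on p q f" "p \<le> p'" "q' \<le> q"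
  shows "absolutely_continuous_fun_on p' q' f"
  unfolding absolutely_continuous_fun_on_def
proof (intro allI impI)
  fix \<epsilon> :: real assume "\<epsilon> > 0"
  then obtain \<eta> where "\<eta> > 0" and H: "\<And>(n::nat) (u::nat \<Rightarrow> real) v.
        (\<forall>i<n. p \<le> u i \<and> u i \<le> v i \<and> v i \<le> q) \<Longrightarrow>
        disjoint_family_on (\<lambda>i. {u i<..<v i}) {..<n} \<Longrightarrow>
        (\<Sum>i<n. v i - u i) < \<eta> \<Longrightarrow> (\<Sum>i<n. \<bar>f (v i) - f (u i)\<bar>) < \<epsilon>"
    using assms(1) unfolding absolutely_continuous_fun_on_def by meson
  show "\<exists>\<eta>>0. \<forall>(n::nat) (u::nat \<Rightarrow> real) v. (\<forall>i<n. p' \<le> u i \<and> u i \<le> v i \<and> v i \<le> q') \<longrightarrow>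
        disjoint_family_on (\<lambda>i. {u i<..<v i}) {..<n} \<longrightarrow>
        (\<Sum>i<n. v i - u i) < \<eta> \<longrightarrow> (\<Sum>i<n. \<bar>f (v i) - f (u i)\<bar>) < \<epsilon>"
  proof (intro exI conjI allI impI)
    show "\<eta> > 0" by fact
    fix n :: nat and u v :: "nat \<Rightarrow> real"
    assume "\<forall>i<n. p' \<le> u i \<and> u i \<le> v i \<and> v i \<le> q'"
      "disjoint_family_on (\<lambda>i. {u i<..<v i}) {..<n}" "(\<Sum>i<n. v i - u i) < \<eta>"
    with assms(2,3) show "(\<Sum>i<n. \<bar>f (v i) - f (u i)\<bar>) < \<epsilon>"
      by (intro H) (auto intro: order_trans)
  qed
qed

text \<open>Straddle lemma for the tags outside \<open>N\<close>; the intervals tagged in \<open>N\<close> have small total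
  length, so absolute continuity controls their increments.\<close>

lemma fundamental_theorem_of_calculus_absolutely_continuous:
  fixes f f' :: "real \<Rightarrow> real"
  assumes pq: "p \<le> q" and AC: "absolutely_continuous_fun_on p q f" and N: "negligible N"
    and vd: "\<And>x. x \<in> {p..q} - N \<Longrightarrow> (f has_vector_derivative f' x) (at x within {p..q})"
  shows "(f' has_integral (f q - f p)) {p..q}"
proof -
  \<comment> \<open>With the value 0 on \<open>N\<close>, a tag in \<open>N\<close> contributes only
    the increment of \<open>f\<close> over its interval.\<close>
  define F where "F x = (if x \<in> N then 0 else f' x)" for x
  have "(F has_integral (f q - f p)) {p..q}"
    unfolding has_integral_real
  proof (intro allI impI)
    fix e :: real assume e: "e > 0"
    \<comment> \<open>Half of \<open>e\<close> is spent on the tags outside \<open>N\<close>, the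
      other half on the tags in \<open>N\<close>. The summand 1 keeps the denominator positive when
      \<open>p = q\<close>.\<close>
    define e1 where "e1 = e / (2 * (q - p + 1))"
    have e1: "e1 > 0" "e1 * (q - p) < e / 2"
      using pq e by (auto simp: e1_def field_simps)
    have "\<exists>d>0. \<forall>y\<in>{p..q}. \<bar>y - x\<bar> < d \<longrightarrow> \<bar>f y - f x - (y - x) * f' x\<bar> \<le> e1 * \<bar>y - x\<bar>"
      if "x \<in> {p..q} - N" for x
      using vd[OF that] e1(1) unfolding has_vector_derivative_def has_derivative_within_alt
      by (auto simp: real_norm_def)
    then obtain d where d: "\<And>x. x \<in> {p..q} - N \<Longrightarrow> d x > 0"
      and dd: "\<And>x y. x \<in> {p..q} - N \<Longrightarrow> y \<in> {p..q} \<Longrightarrow> \<bar>y - x\<bar> < d x \<Longrightarrow>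
            \<bar>f y - f x - (y - x) * f' x\<bar> \<le> e1 * \<bar>y - x\<bar>"
      by metis
    obtain \<eta> where \<eta>: "\<eta> > 0"
      and H: "\<And>I (u::real \<times> real set \<Rightarrow> real) v. finite I \<Longrightarrow>
      (\<forall>i\<in>I. p \<le> u i \<and> u i \<le> v i \<and> v i \<le> q) \<Longrightarrow>
      disjoint_family_on (\<lambda>i. {u i<..<v i}) I \<Longrightarrow> (\<Sum>i\<in>I. v i - u i) < \<eta> \<Longrightarrow>
      (\<Sum>i\<in>I. \<bar>f (v i) - f (u i)\<bar>) < e / 2"
      using absolutely_continuous_fun_onD[OF AC half_gt_zero[OF e]] by blast
    \<comment> \<open>The gauge will force intervals tagged in \<open>N\<close> into
      \<open>G\<close>, so that their total length stays below the threshold \<open>\<eta>\<close>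
      of absolute continuity.\<close>
    obtain G where G: "open G" "N \<subseteq> G" "G \<in> lmeasurable" "measure lebesgue G < \<eta>"
    proof -
      have "N \<in> null_sets lebesgue" using N negligible_iff_null_sets by blast
      then have NL: "N \<in> sets lebesgue" "emeasure lebesgue N = 0" by auto
      from sets_lebesgue_outer_open[OF NL(1) \<eta>] obtain G where
        G: "open G" "N \<subseteq> G" "(G - N) \<in> lmeasurable" "emeasure lebesgue (G - N) < ennreal \<eta>"
        by metis
      have "N \<in> lmeasurable" using NL by (simp add: fmeasurableI)
      with G(2,3) have GL: "G \<in> lmeasurable"
        using fmeasurable.Un[of "G - N" lebesgue N] by (simp add: Un_absorb2)
      have "measure lebesgue (G - N) < \<eta>"
        using G(3,4) \<eta> by (simp add: emeasure_eq_measure2 fmeasurableD ennreal_less_iff)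
      moreover have "measure lebesgue G = measure lebesgue (G - N)"
        using measure_Diff_null_set[of G lebesgue N] NL GL \<open>N \<in> null_sets lebesgue\<close>
        by (simp add: fmeasurableD)
      ultimately show thesis using that[of G] G GL by auto
    qed
    define \<gamma> where "\<gamma> x = (if x \<in> N then G else if x \<in> {p..q} then ball x (d x) else ball x 1)" for x
    have gauge: "gauge \<gamma>"
      unfolding gauge_def \<gamma>_def using G d by auto
    have bound: "norm (sum (\<lambda>(x,k). measure lborel k *\<^sub>R F x) D - (f q - f p)) < e"
      if D: "D tagged_division_of {p..q}" and fine: "\<gamma> fine D" for D
    proof -
      have fD: "finite D" using D by auto
      have iv: "\<exists>u v. K = {u..v} \<and> u \<le> x \<and> x \<le> v \<and> p \<le> u \<and> v \<le> q \<and> x \<in> {p..q} \<and> {u..v} \<subseteq> \<gamma> x"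
        if "(x, K) \<in> D" for x K
      proof -
        obtain u v where "K = cbox u v" using tagged_division_ofD(4)[OF D \<open>(x, K) \<in> D\<close>] by metis
        moreover have "x \<in> K" "K \<subseteq> {p..q}" "K \<subseteq> \<gamma> x"
          using tagged_division_ofD[OF D] that fine by (auto simp: fine_def)
        ultimately show ?thesis by (intro exI[of _ u] exI[of _ v]) auto
      qed
      let ?T = "\<lambda>(x,K). measure lborel K *\<^sub>R F x - (f (Sup K) - f (Inf K))"
      let ?D1 = "{z\<in>D. fst z \<in> N}" and ?D2 = "{z\<in>D. fst z \<notin> N}"
      have "(\<Sum>z\<in>?D1. Sup (snd z) - Inf (snd z)) < \<eta>"
      proof -
        \<comment> \<open>Neighbouring intervals of a division share end points; their interiors are
          disjoint and have the same lengths.\<close>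
        have "(\<Sum>z\<in>?D1. Sup (snd z) - Inf (snd z)) = (\<Sum>z\<in>?D1. measure lebesgue (interior (snd z)))"
        proof (rule sum.cong[OF refl])
          fix z assume "z \<in> ?D1"
          then obtain u v where "snd z = {u..v}" "u \<le> v" using iv[of "fst z" "snd z"] by auto
          then show "Sup (snd z) - Inf (snd z) = measure lebesgue (interior (snd z))"
            by (simp add: interior_atLeastAtMost_real)
        qed
        also have "\<dots> = measure lebesgue (\<Union>z\<in>?D1. interior (snd z))"
        proof (rule measure_finite_Union[symmetric])
          show "finite ?D1" using fD by simp
          show "(\<lambda>z. interior (snd z)) ` ?D1 \<subseteq> sets lebesgue" by auto
          show "disjoint_family_on (\<lambda>z. interior (snd z)) ?D1"
            unfolding disjoint_family_on_def
            using tagged_division_ofD(5)[OF D] by (metis (no_types, lifting) mem_Collect_eq prod.collapse)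
          fix z assume "z \<in> ?D1"
          then obtain u v where "snd z = {u..v}" "u \<le> v" using iv[of "fst z" "snd z"] by auto
          then show "emeasure lebesgue (interior (snd z)) \<noteq> \<infinity>"
            by (simp add: interior_atLeastAtMost_real)
        qed
        also have "\<dots> \<le> measure lebesgue G"
        proof (rule measure_mono_fmeasurable)
          show "(\<Union>z\<in>?D1. interior (snd z)) \<subseteq> G"
          proof
            fix y assume "y \<in> (\<Union>z\<in>?D1. interior (snd z))"
            then obtain x K where xK: "(x, K) \<in> D" "x \<in> N" "y \<in> interior K" by auto
            then show "y \<in> G" using iv[of x K] interior_subset[of K] by (auto simp: \<gamma>_def)
          qed
          show "(\<Union>z\<in>?D1. interior (snd z)) \<in> sets lebesgue"
            by (rule sets.finite_UN) (use fD in auto)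
        qed (use G in auto)
        finally show ?thesis using G by simp
      qed
      then have S1: "(\<Sum>z\<in>?D1. \<bar>f (Sup (snd z)) - f (Inf (snd z))\<bar>) < e / 2"
      proof (intro H)
        show "finite ?D1" using fD by simp
        show "\<forall>z\<in>?D1. p \<le> Inf (snd z) \<and> Inf (snd z) \<le> Sup (snd z) \<and> Sup (snd z) \<le> q"
        proof
          fix z assume "z \<in> ?D1"
          then obtain u v where "snd z = {u..v}" "u \<le> v" "p \<le> u" "v \<le> q"
            using iv[of "fst z" "snd z"] by force
          then show "p \<le> Inf (snd z) \<and> Inf (snd z) \<le> Sup (snd z) \<and> Sup (snd z) \<le> q" by simp
        qed
        have *: "{Inf (snd z)<..<Sup (snd z)} = interior (snd z)" if "z \<in> ?D1" for z
        proof -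
          obtain u v where "snd z = {u..v}" "u \<le> v" using iv[of "fst z" "snd z"] \<open>z \<in> ?D1\<close> by auto
          then show ?thesis by (simp add: interior_atLeastAtMost_real)
        qed
        show "disjoint_family_on (\<lambda>z. {Inf (snd z)<..<Sup (snd z)}) ?D1"
          unfolding disjoint_family_on_def
        proof (intro ballI impI)
          fix z z' assume z: "z \<in> ?D1" "z' \<in> ?D1" "z \<noteq> z'"
          then have "interior (snd z) \<inter> interior (snd z') = {}"
            using tagged_division_ofD(5)[OF D, of "fst z" "snd z" "fst z'" "snd z'"] by auto
          then show "{Inf (snd z)<..<Sup (snd z)} \<inter> {Inf (snd z')<..<Sup (snd z')} = {}"
            using * z by simp
        qed
      qed
      have "\<bar>sum ?T ?D1\<bar> \<le> (\<Sum>z\<in>?D1. \<bar>f (Sup (snd z)) - f (Inf (snd z))\<bar>)"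
        by (intro order_trans[OF sum_abs] sum_mono) (auto simp: F_def)
      with S1 have T1: "\<bar>sum ?T ?D1\<bar> < e / 2" by simp
      have "\<bar>sum ?T ?D2\<bar> \<le> (\<Sum>(x,K)\<in>?D2. e1 * (Sup K - Inf K))"
      proof (intro order_trans[OF sum_abs] sum_mono, clarify)
        fix x K assume xK: "(x, K) \<in> D" "fst (x, K) \<notin> N"
        then obtain u v where K: "K = {u..v}" "u \<le> x" "x \<le> v" "p \<le> u" "v \<le> q" "x \<in> {p..q}" "{u..v} \<subseteq> \<gamma> x"
          using iv[OF xK(1)] by auto
        have xN: "x \<in> {p..q} - N" using K xK by auto
        have "u \<in> \<gamma> x" "v \<in> \<gamma> x" using K by auto
        then have uv: "\<bar>u - x\<bar> < d x" "\<bar>v - x\<bar> < d x"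
          using xN by (auto simp: \<gamma>_def dist_real_def abs_minus_commute)
        have "\<bar>f u - f x - (u - x) * f' x\<bar> \<le> e1 * (x - u)" "\<bar>f v - f x - (v - x) * f' x\<bar> \<le> e1 * (v - x)"
          using dd[OF xN _ uv(1)] dd[OF xN _ uv(2)] K by auto
        moreover have "(v - u) * f' x - (f v - f u) = (f u - f x - (u - x) * f' x) - (f v - f x - (v - x) * f' x)"
          "e1 * (v - u) = e1 * (x - u) + e1 * (v - x)"
          by (simp_all add: algebra_simps)
        ultimately have "\<bar>(v - u) * f' x - (f v - f u)\<bar> \<le> e1 * (v - u)"
          by linarith
        then show "\<bar>measure lborel K *\<^sub>R F x - (f (Sup K) - f (Inf K))\<bar> \<le> e1 * (Sup K - Inf K)"
          using K xN by (simp add: F_def)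
      qed
      also have "\<dots> \<le> (\<Sum>(x,K)\<in>D. e1 * (Sup K - Inf K))"
        using fD e1 iv by (intro sum_mono2) fastforce+
      also have "\<dots> = e1 * (q - p)"
        using additive_tagged_division_1[OF pq D, of "\<lambda>x. x"]
        by (simp add: sum_distrib_left[symmetric] split_def)
      finally have T2: "\<bar>sum ?T ?D2\<bar> < e / 2" using e1 by simp
      have "sum (\<lambda>(x,k). measure lborel k *\<^sub>R F x) D - (f q - f p) = sum ?T D"
        using additive_tagged_division_1[OF pq D, of f] by (simp add: sum_subtractf split_def)
      also have "\<dots> = sum ?T ?D1 + sum ?T ?D2"
        using fD by (subst sum.union_disjoint[symmetric]) (auto intro!: sum.cong)
      finally show ?thesis using T1 T2 by simp
    qed
    show "\<exists>\<gamma>. gauge \<gamma> \<and> (\<forall>\<D>. \<D> tagged_division_of {p..q} \<and> \<gamma> fine \<D> \<longrightarrow>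
        norm (sum (\<lambda>(x,k). measure lborel k *\<^sub>R F x) \<D> - (f q - f p)) < e)"
      by (intro exI[of _ \<gamma>] conjI gauge allI impI bound) (erule conjE, assumption)+
  qed
  then show ?thesis
    by (rule has_integral_spike[OF N, rotated]) (auto simp: F_def)
qed

section \<open>Exponentials of indefinite integrals\<close>

text \<open>Difference quotients are bounded by a multiple of the step, so the derivative vanishes
  everywhere. This stands in for the chain rule below, where the inner function is an indefinite
  integral that may fail to be differentiable at some points.\<close>

lemma quadratic_increments_imp_constant:
  fixes f :: "real \<Rightarrow> real"
  assumes "p \<le> q" and le: "\<And>s t. p \<le> s \<Longrightarrow> s \<le> t \<Longrightarrow> t \<le> q \<Longrightarrow> \<bar>f t - f s\<bar> \<le> C * (t - s)\<^sup>2"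
  shows "f p = f q"
proof -
  have le': "\<bar>f y - f x\<bar> \<le> C * (y - x)\<^sup>2" if "x \<in> {p..q}" "y \<in> {p..q}" for x y
    using le[of x y] le[of y x] that by (cases "x \<le> y") (auto simp: abs_minus_commute power2_commute)
  have "(f has_derivative (\<lambda>h. 0)) (at x within {p..q})" if x: "x \<in> {p..q}" for x
    unfolding has_derivative_within_alt
  proof (intro conjI allI impI)
    fix e :: real assume e: "e > 0"
    have "norm (f y - f x - 0) \<le> e * norm (y - x)" if y: "y \<in> {p..q}" "norm (y - x) < e / (\<bar>C\<bar> + 1)" for y
    proof -
      have "(\<bar>C\<bar> + 1) * \<bar>y - x\<bar> \<le> e" using y(2) by (simp add: field_simps)
      have "\<bar>f y - f x\<bar> \<le> C * (y - x)\<^sup>2" by (rule le'[OF x y(1)])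
      also have "\<dots> \<le> (\<bar>C\<bar> + 1) * (y - x)\<^sup>2" by (rule mult_right_mono) auto
      also have "\<dots> = ((\<bar>C\<bar> + 1) * \<bar>y - x\<bar>) * \<bar>y - x\<bar>" by (simp add: power2_eq_square)
      also have "\<dots> \<le> e * \<bar>y - x\<bar>" by (rule mult_right_mono) (use \<open>_ \<le> e\<close> in auto)
      finally show ?thesis by simp
    qed
    then show "\<exists>d>0. \<forall>y\<in>{p..q}. norm (y - x) < d \<longrightarrow> norm (f y - f x - 0) \<le> e * norm (y - x)"
      using e by (intro exI[of _ "e / (\<bar>C\<bar> + 1)"]) auto
  qed simp
  then obtain c where "\<And>x. x \<in> {p..q} \<Longrightarrow> f x = c"
    using has_derivative_zero_constant[of "{p..q}" f] by auto
  then show ?thesis using assms(1) by auto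
qed

text \<open>Stated with integrals because the exponent need not be differentiable everywhere.\<close>

lemma has_integral_exp_indefinite_integral:
  fixes B :: "real \<Rightarrow> real"
  assumes c: "c \<ge> 0" and pq: "\<sigma> \<le> p" "p \<le> q" "q \<le> T" and B: "B integrable_on {\<sigma>..T}"
    and B_bd: "\<And>t. t \<in> {\<sigma>..T} \<Longrightarrow> 0 \<le> B t \<and> B t \<le> \<beta>"
  defines "w \<equiv> \<lambda>t. exp (- c * integral {\<sigma>..t} B)"
  shows "((\<lambda>r. c * (B r * w r)) has_integral (w p - w q)) {p..q}"
proof -
  have Bsub: "B integrable_on {s..t}" if "\<sigma> \<le> s" "t \<le> T" for s t
    by (rule integrable_on_subinterval[OF B]) (use that in auto)
  have w_cont: "continuous_on {\<sigma>..T} w"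
    unfolding w_def by (intro continuous_intros indefinite_integral_continuous_1 B)
  have Bw: "(\<lambda>r. B r * w r) integrable_on {s..t}" if st: "\<sigma> \<le> s" "t \<le> T" for s t
  proof -
    have "(\<lambda>r. w r * B r) absolutely_integrable_on {s..t}"
    proof (rule absolutely_integrable_bounded_measurable_product_real)
      show "w \<in> borel_measurable (lebesgue_on {s..t})"
        by (rule continuous_imp_measurable_on_sets_lebesgue)
          (use w_cont st in \<open>auto intro: continuous_on_subset\<close>)
      show "bounded (w ` {s..t})"
        by (intro compact_imp_bounded compact_continuous_image continuous_on_subset[OF w_cont])
          (use st in auto)
      show "B absolutely_integrable_on {s..t}"
        by (rule nonnegative_absolutely_integrable_1[OF Bsub[OF st]]) (use B_bd st in auto)
    qed auto
    then show ?thesis by (simp add: mult.commute absolutely_integrable_on_def)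
  qed
  \<comment> \<open>\<open>D\<close> is the quantity that the claim asserts to be constant. On a
    short interval \<open>w\<close> is decreasing, so freezing it at either end encloses the
    integral of \<open>B r * w r\<close>; the increments of \<open>D\<close> are then of second
    order in \<open>\<delta>\<close>, and \<open>\<delta>\<close> is at most a multiple of
    \<open>t - s\<close> because \<open>B\<close> is bounded.\<close>
  define D where "D t = w t + c * integral {p..t} (\<lambda>r. B r * w r)" for t
  have "D p = D q"
  proof (rule quadratic_increments_imp_constant[OF pq(2)])
    fix s t assume st: "p \<le> s" "s \<le> t" "t \<le> q"
    define \<delta> where "\<delta> = c * integral {s..t} B"
    have comb: "integral {\<sigma>..r} B + integral {r..r'} B = integral {\<sigma>..r'} B"
      if "\<sigma> \<le> r" "r \<le> r'" "r' \<le> T" for r r'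
      by (rule Henstock_Kurzweil_Integration.integral_combine) (use that Bsub in auto)
    have nn: "integral {r..r'} B \<ge> 0" if "\<sigma> \<le> r" "r' \<le> T" for r r'
      by (rule integral_nonneg[OF Bsub]) (use that B_bd in auto)
    have w_mono: "w r' \<le> w r" if "\<sigma> \<le> r" "r \<le> r'" "r' \<le> T" for r r'
      using comb[OF that] nn[of r r'] that c unfolding w_def by (auto intro!: mult_left_mono)
    have wt: "w t = w s * exp (- \<delta>)"
      using arg_cong[OF comb[of s t], of "\<lambda>z. c * z"] st pq
      unfolding w_def \<delta>_def by (simp add: mult_exp_exp distrib_left)
    have ws: "0 < w s" "w s \<le> 1"
      using nn[of \<sigma> s] st pq c by (auto simp: w_def)
    have \<delta>0: "\<delta> \<ge> 0" using nn[of s t] st pq c by (auto simp: \<delta>_def)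
    have "integral {s..t} B \<le> integral {s..t} (\<lambda>_. \<beta>)"
      by (rule integral_le[OF Bsub]) (use st pq B_bd in auto)
    then have \<delta>1: "\<delta> \<le> c * \<beta> * (t - s)"
      using c st by (simp add: \<delta>_def mult_left_mono mult.assoc mult.commute[of "t - s"])
    have up: "c * integral {s..t} (\<lambda>r. B r * w r) \<le> w s * \<delta>"
    proof -
      have "integral {s..t} (\<lambda>r. B r * w r) \<le> integral {s..t} (\<lambda>r. B r * w s)"
        by (rule integral_le[OF Bw]) (use st pq B_bd w_mono Bsub in \<open>auto intro!: mult_left_mono integrable_on_mult_left\<close>)
      then show ?thesis using c by (simp add: \<delta>_def mult_left_mono mult.left_commute mult.commute)
    qed
    have low: "w t * \<delta> \<le> c * integral {s..t} (\<lambda>r. B r * w r)"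
    proof -
      have "integral {s..t} (\<lambda>r. B r * w t) \<le> integral {s..t} (\<lambda>r. B r * w r)"
        by (rule integral_le[OF _ Bw]) (use st pq B_bd w_mono Bsub in \<open>auto intro!: mult_left_mono integrable_on_mult_left\<close>)
      then show ?thesis using c by (simp add: \<delta>_def mult_left_mono mult.left_commute mult.commute)
    qed
    have Dts: "D t - D s = w t - w s + c * integral {s..t} (\<lambda>r. B r * w r)"
    proof -
      have "integral {p..s} (\<lambda>r. B r * w r) + integral {s..t} (\<lambda>r. B r * w r) = integral {p..t} (\<lambda>r. B r * w r)"
        by (rule Henstock_Kurzweil_Integration.integral_combine) (use st pq Bw in auto)
      then show ?thesis unfolding D_def by (simp add: algebra_simps flip: \<open>_ = integral {p..t} _\<close>)
    qed
    \<comment> \<open>The upper bound follows from 1 + \<delta> \<le> exp \<delta> and (1 +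
      \<delta>)(1 - \<delta> + \<delta>^2) = 1 + \<delta>^3 \<ge> 1; the lower bound
      \<open>e2\<close> from exp(-\<delta>) \<ge> 1 - \<delta>.\<close>
    have e1: "exp (- \<delta>) \<le> 1 - \<delta> + \<delta>\<^sup>2"
    proof -
      have "(1 + \<delta>) * exp (- \<delta>) \<le> exp \<delta> * exp (- \<delta>)"
        by (rule mult_right_mono) auto
      also have "\<dots> = 1" by (simp add: mult_exp_exp)
      also have "\<dots> \<le> (1 + \<delta>) * (1 - \<delta> + \<delta>\<^sup>2)"
        using \<delta>0 by (simp add: algebra_simps power2_eq_square)
      finally show ?thesis using \<delta>0 by (simp add: mult_le_cancel_left_pos)
    qed
    have e2: "(1 + \<delta>) * exp (- \<delta>) \<ge> 1 - \<delta>\<^sup>2"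
      using mult_left_mono[OF exp_ge_add_one_self[of "- \<delta>"], of "1 + \<delta>"] \<delta>0
      by (simp add: algebra_simps power2_eq_square)
    have "D t - D s \<le> w s * (exp (- \<delta>) - 1 + \<delta>)"
      using up by (simp add: Dts wt algebra_simps)
    also have "\<dots> \<le> w s * \<delta>\<^sup>2" using e1 ws by (intro mult_left_mono) auto
    also have "\<dots> \<le> \<delta>\<^sup>2" using ws by (simp add: mult_left_le_one_le)
    finally have 1: "D t - D s \<le> \<delta>\<^sup>2" .
    have "- \<delta>\<^sup>2 \<le> - (w s * \<delta>\<^sup>2)" using ws by (simp add: mult_left_le_one_le)
    also have "\<dots> \<le> w s * ((1 + \<delta>) * exp (- \<delta>) - 1)"
      using mult_left_mono[OF e2, of "w s"] ws by (simp add: algebra_simps)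
    also have "\<dots> \<le> D t - D s"
      using low by (simp add: Dts wt algebra_simps)
    finally have "\<bar>D t - D s\<bar> \<le> \<delta>\<^sup>2" using 1 by auto
    also have "\<dots> \<le> (c * \<beta> * (t - s))\<^sup>2" by (rule power_mono[OF \<delta>1 \<delta>0])
    finally show "\<bar>D t - D s\<bar> \<le> (c * \<beta>)\<^sup>2 * (t - s)\<^sup>2" by (simp add: power_mult_distrib)
  qed
  then have "w p - w q = c * integral {p..q} (\<lambda>r. B r * w r)" by (simp add: D_def)
  moreover have "((\<lambda>r. c * (B r * w r)) has_integral c * integral {p..q} (\<lambda>r. B r * w r)) {p..q}"
    by (intro has_integral_mult_right integrable_integral Bw) (use pq in auto)
  ultimately show ?thesis by simp
qed

section \<open>Comparison for scalar delay inequalities\<close>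

text \<open>In the comparison arguments a function and its derivative are linked only by this
  integral relation. Continuity is recovered from it so that maxima over compact intervals are
  attained.\<close>

lemma continuous_on_primitive:
  fixes u u' :: "real \<Rightarrow> real"
  assumes "\<And>s t. \<sigma> \<le> s \<Longrightarrow> s \<le> t \<Longrightarrow> t \<le> T \<Longrightarrow> (u' has_integral (u t - u s)) {s..t}"
  shows "continuous_on {\<sigma>..T} u"
proof (cases "\<sigma> \<le> T")
  case True
  have "continuous_on {\<sigma>..T} (\<lambda>t. u \<sigma> + integral {\<sigma>..t} u')"
    using assms[of \<sigma> T] True
    by (intro continuous_intros indefinite_integral_continuous_1) (auto intro: has_integral_integrable)
  moreover have "u \<sigma> + integral {\<sigma>..t} u' = u t" if "t \<in> {\<sigma>..T}" for t
    using integral_unique[OF assms[of \<sigma> t]] that by auto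
  ultimately show ?thesis by (rule continuous_on_eq)
qed auto

text \<open>With \<open>w(t) = exp (-e \<integral>B)\<close>, which decreases by at most a factor \<open>e\<close> over one delay, let
  \<open>m\<close> be the maximum of \<open>u / w\<close> on \<open>[\<sigma>, T]\<close>. To the right of a point where it is attained,
  \<open>u\<close> decreases no faster than \<open>m w\<close>, hence \<open>u T \<ge> m w T \<ge> 0\<close>.\<close>

lemma delay_differential_inequality_nonneg:
  fixes u u' B h0 :: "real \<Rightarrow> real"
  assumes sT: "\<sigma> \<le> T" and N: "negligible N"
    and u: "\<And>s t. \<sigma> \<le> s \<Longrightarrow> s \<le> t \<Longrightarrow> t \<le> T \<Longrightarrow> (u' has_integral (u t - u s)) {s..t}"
    and hist: "\<And>s. s < \<sigma> \<Longrightarrow> u s \<le> u \<sigma>" and u0: "u \<sigma> \<ge> 0"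
    and B: "B integrable_on {\<sigma>..T}"
    and B_bd: "\<And>t. t \<in> {\<sigma>..T} \<Longrightarrow> 0 \<le> B t \<and> B t \<le> \<beta>"
    and B_int: "\<And>t. t \<in> {\<sigma>..T} \<Longrightarrow> integral {max \<sigma> (h0 t)..t} B \<le> 1 / exp 1"
    and ineq: "\<And>t m. t \<in> {\<sigma>..T} - N \<Longrightarrow> 0 \<le> m \<Longrightarrow> (\<And>s. h0 t \<le> s \<Longrightarrow> s \<le> t \<Longrightarrow> u s \<le> m) \<Longrightarrow>
        - (B t * m) \<le> u' t"
  shows "u T \<ge> 0"
proof -
  define w where "w t = exp (- exp 1 * integral {\<sigma>..t} B)" for t
  have w_pos: "w t > 0" for t by (simp add: w_def)
  have w_s: "w \<sigma> = 1" by (simp add: w_def)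
  have w_cont: "continuous_on {\<sigma>..T} w"
    unfolding w_def by (intro continuous_intros indefinite_integral_continuous_1 B)
  have u_cont: "continuous_on {\<sigma>..T} u"
    by (rule continuous_on_primitive[OF u])
  have Bsub: "B integrable_on {s..t}" if "\<sigma> \<le> s" "t \<le> T" for s t
    by (rule integrable_on_subinterval[OF B]) (use that in auto)
  obtain t1 where t1: "t1 \<in> {\<sigma>..T}" and max: "\<And>t. t \<in> {\<sigma>..T} \<Longrightarrow> u t / w t \<le> u t1 / w t1"
  proof -
    have "\<exists>x\<in>{\<sigma>..T}. \<forall>y\<in>{\<sigma>..T}. u y / w y \<le> u x / w x"
      by (rule continuous_attains_sup)
        (use sT w_pos in \<open>auto intro!: continuous_intros u_cont w_cont simp: less_imp_neq[symmetric]\<close>)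
    then show thesis using that by blast
  qed
  define m where "m = u t1 / w t1"
  have u_le: "u t \<le> m * w t" if "t \<in> {\<sigma>..T}" for t
    using max[OF that] w_pos[of t] by (simp add: m_def divide_le_eq)
  have m_s: "u \<sigma> \<le> m" using u_le[of \<sigma>] sT w_s by simp
  then have m0: "m \<ge> 0" using u0 by simp
  have w_delay: "w s \<le> exp 1 * w t" if t: "t \<in> {\<sigma>..T}" and s: "max \<sigma> (h0 t) \<le> s" "s \<le> t" for s t
  proof -
    have "integral {max \<sigma> (h0 t)..s} B + integral {s..t} B = integral {max \<sigma> (h0 t)..t} B"
      by (rule Henstock_Kurzweil_Integration.integral_combine) (use t s Bsub in auto)
    moreover have "integral {max \<sigma> (h0 t)..s} B \<ge> 0"
      by (rule integral_nonneg[OF Bsub]) (use t s B_bd in auto)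
    ultimately have "integral {s..t} B \<le> 1 / exp 1" using B_int[OF t] by simp
    then have "exp 1 * integral {s..t} B \<le> 1" by (simp add: field_simps)
    moreover have "integral {\<sigma>..s} B + integral {s..t} B = integral {\<sigma>..t} B"
      by (rule Henstock_Kurzweil_Integration.integral_combine) (use t s Bsub in auto)
    ultimately have "- exp 1 * integral {\<sigma>..s} B \<le> 1 + - exp 1 * integral {\<sigma>..t} B"
      by (simp add: algebra_simps flip: \<open>_ = integral {\<sigma>..t} B\<close>)
    then show ?thesis unfolding w_def mult_exp_exp by simp
  qed
  have u'_ge: "- m * (exp 1 * (B t * w t)) \<le> u' t" if t: "t \<in> {\<sigma>..T} - N" for t
  proof -
    have "- (B t * (m * (exp 1 * w t))) \<le> u' t"
    proof (rule ineq[OF t])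
      show "0 \<le> m * (exp 1 * w t)" using m0 w_pos[of t] by simp
      fix s assume s: "h0 t \<le> s" "s \<le> t"
      show "u s \<le> m * (exp 1 * w t)"
      proof (cases "\<sigma> \<le> s")
        case True
        have "u s \<le> m * w s" by (rule u_le) (use t s True in auto)
        also have "\<dots> \<le> m * (exp 1 * w t)"
          by (rule mult_left_mono[OF w_delay m0]) (use t s True in auto)
        finally show ?thesis .
      next
        case False
        \<comment> \<open>A history value is dominated by the value at \<open>\<sigma>\<close>, and
          \<open>\<sigma>\<close> itself lies in the delay interval since
          \<open>h0 t \<le> s\<close> and \<open>s < \<sigma>\<close>; so \<open>w_delay\<close>
          applies at \<open>\<sigma>\<close>.\<close>
        have "u s \<le> m * w \<sigma>" using hist[of s] m_s False w_s by simp
        also have "\<dots> \<le> m * (exp 1 * w t)"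
          by (rule mult_left_mono[OF w_delay m0]) (use t s False in auto)
        finally show ?thesis .
      qed
    qed
    then show ?thesis by (simp add: mult_ac)
  qed
  \<comment> \<open>On the null set the derivative is replaced by the lower bound itself, so the
    inequality between the integrands holds at every point.\<close>
  define F where "F t = (if t \<in> N then - m * (exp 1 * (B t * w t)) else u' t)" for t
  have "(u' has_integral (u T - u t1)) {t1..T}"
    by (rule u) (use t1 in auto)
  then have "(F has_integral (u T - u t1)) {t1..T}"
    by (rule has_integral_spike[OF N, rotated]) (auto simp: F_def)
  then have "- m * (w t1 - w T) \<le> u T - u t1"
  proof (rule has_integral_le[rotated])
    show "((\<lambda>t. - m * (exp 1 * (B t * w t))) has_integral (- m * (w t1 - w T))) {t1..T}"
      unfolding w_def
      by (intro has_integral_mult_right has_integral_exp_indefinite_integral[where T=T and \<beta>=\<beta>])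
        (use t1 B B_bd in auto)
    show "- m * (exp 1 * (B t * w t)) \<le> F t" if "t \<in> {t1..T}" for t
      using u'_ge[of t] t1 that by (auto simp: F_def)
  qed
  moreover have "u t1 = m * w t1" using w_pos[of t1] by (simp add: m_def)
  ultimately have "m * w T \<le> u T" by (simp add: algebra_simps)
  moreover have "0 \<le> m * w T" using m0 w_pos[of T] by simp
  ultimately show ?thesis by linarith
qed

text \<open>The nonnegativity lemma is applied to a decaying barrier minus \<open>x\<close>.
  \<open>S\<close> is known only through the mean value property, which is all that the comparison
  uses. \<open>G\<close> bounds the forcing relative to \<open>B\<close>, \<open>C\<close> is the
  share of the barrier that absorbs forcing, and \<open>D\<close> the share that also covers the
  history. \<open>GCD\<close> says that the barrier is a supersolution: decay at rate
  \<open>\<gamma>\<close> costs \<open>\<gamma>\<close> in both shares, and only half of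
  \<open>D\<close> is visible through the delay.\<close>

lemma delay_equation_upper_bound:
  fixes x x' B S h0 :: "real \<Rightarrow> real"
  assumes sT: "\<sigma> \<le> T" and N: "negligible N"
    and x: "\<And>s t. \<sigma> \<le> s \<Longrightarrow> s \<le> t \<Longrightarrow> t \<le> T \<Longrightarrow> (x' has_integral (x t - x s)) {s..t}"
    and hist: "\<And>s. s \<le> \<sigma> \<Longrightarrow> \<bar>x s\<bar> \<le> J"
    and B: "B integrable_on {\<sigma>..T}"
    and B_bd: "\<And>t. t \<in> {\<sigma>..T} \<Longrightarrow> \<beta>1 \<le> B t \<and> B t \<le> \<beta>2" and \<beta>1: "\<beta>1 > 0"
    and B_int: "\<And>t. t \<in> {\<sigma>..T} \<Longrightarrow> integral {max \<sigma> (h0 t)..t} B \<le> 1 / exp 1"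
    and S: "\<And>t c. t \<in> {\<sigma>..T} \<Longrightarrow> (\<And>s. h0 t \<le> s \<Longrightarrow> s \<le> t \<Longrightarrow> c \<le> x s) \<Longrightarrow> c \<le> S t"
    and f: "\<And>t. t \<in> {\<sigma>..T} - N \<Longrightarrow> x' t + B t * S t \<le> B t * (G * exp (- \<gamma> * (t - \<sigma>)))"
    and \<gamma>: "\<gamma> \<ge> 0" and C: "C \<ge> 0" and D: "D \<ge> 4 * J"
    and GCD: "G * \<beta>1 \<le> C * (\<beta>1 - \<gamma>) + D * (\<beta>1 / 2 - \<gamma>)"
  shows "x T \<le> (C + D) * exp (- \<gamma> * (T - \<sigma>))"
proof -
  define p where "p t = exp (- \<gamma> * (t - \<sigma>))" for t
  have p_pos: "p t > 0" for t by (simp add: p_def)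
  have p_le: "p t \<le> 1" if "\<sigma> \<le> t" for t using that \<gamma> by (simp add: p_def)
  have p_mono: "p t \<le> p s" if "s \<le> t" for s t using that \<gamma> by (simp add: p_def mult_left_mono)
  have J: "J \<ge> 0" "\<bar>x \<sigma>\<bar> \<le> J" using hist[of \<sigma>] by auto
  \<comment> \<open>The barrier jumps up by \<open>D / 2\<close> at \<open>\<sigma>\<close>. Since
    \<open>D / 2 \<ge> 2 * J\<close>, this exceeds any possible drop from \<open>x \<sigma>\<close>
    to a history value, which yields the monotonicity required of the history of
    \<open>u\<close>.\<close>
  define u where "u t = (if t < \<sigma> then C + D / 2 else (C + D) * p t) - x t" for t
  define u' where "u' t = (C + D) * (- \<gamma> * p t) - x' t" for t
  have "u T \<ge> 0"
  proof (rule delay_differential_inequality_nonneg[OF sT N, of u' u B \<beta>2 h0])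
    fix s t assume st: "\<sigma> \<le> s" "s \<le> t" "t \<le> T"
    have "((\<lambda>t. - \<gamma> * p t) has_integral (p t - p s)) {s..t}"
      by (rule fundamental_theorem_of_calculus[OF st(2)])
        (auto simp: p_def has_real_derivative_iff_has_vector_derivative[symmetric]
          intro!: derivative_eq_intros)
    then have "((\<lambda>t. (C + D) * (- \<gamma> * p t) - x' t) has_integral ((C + D) * (p t - p s) - (x t - x s))) {s..t}"
      by (intro has_integral_diff has_integral_mult_right x st)
    moreover have "(C + D) * (p t - p s) - (x t - x s) = u t - u s"
      using st by (simp add: u_def algebra_simps)
    ultimately show "(u' has_integral (u t - u s)) {s..t}" by (simp add: u'_def[abs_def])
  next
    fix s assume "s < \<sigma>"
    then show "u s \<le> u \<sigma>" using hist[of s] J D by (simp add: u_def p_def)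
  next
    show "u \<sigma> \<ge> 0" using J C D by (simp add: u_def p_def)
  next
    show "0 \<le> B t \<and> B t \<le> \<beta>2" if "t \<in> {\<sigma>..T}" for t using B_bd[OF that] \<beta>1 by auto
  next
    fix t m :: real assume t: "t \<in> {\<sigma>..T} - N" and m: "0 \<le> m"
      and um: "\<And>s. h0 t \<le> s \<Longrightarrow> s \<le> t \<Longrightarrow> u s \<le> m"
    have Bt: "\<beta>1 \<le> B t" using B_bd t by auto
    have "(C + D / 2) * p t - m \<le> S t"
    proof (rule S)
      fix s assume s: "h0 t \<le> s" "s \<le> t"
      have "(C + D / 2) * p t \<le> u s + x s"
      proof (cases "s < \<sigma>")
        case True
        then show ?thesis using mult_left_mono[OF p_le[of t], of "C + D / 2"] t C D J
          by (simp add: u_def)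
      next
        case False
        have "(C + D / 2) * p t \<le> (C + D) * p s"
          by (rule mult_mono) (use p_mono[OF s(2)] p_pos[of t] C D J in auto)
        then show ?thesis using False by (simp add: u_def)
      qed
      then show "(C + D / 2) * p t - m \<le> x s" using um[OF s] by simp
    qed (use t in auto)
    then have "B t * ((C + D / 2) * p t - m) \<le> B t * S t"
      using Bt \<beta>1 by (intro mult_left_mono) auto
    then have x't: "x' t \<le> B t * G * p t - B t * ((C + D / 2) * p t - m)"
      using f[OF t] by (simp add: p_def mult.assoc)
    \<comment> \<open>This rearranges \<open>GCD\<close>. The sign of \<open>C + D / 2 - G\<close>
      has to be settled before \<open>\<beta>1\<close> may be replaced by the larger
      \<open>B t\<close>.\<close>
    have "\<gamma> * (C + D) \<le> (C + D / 2 - G) * \<beta>1" using GCD by (simp add: algebra_simps)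
    moreover have "0 \<le> \<gamma> * (C + D)" using \<gamma> C D J by simp
    ultimately have "0 \<le> C + D / 2 - G" using \<beta>1 by (metis order_trans zero_le_mult_iff not_le)
    then have "\<gamma> * (C + D) \<le> (C + D / 2 - G) * B t"
      using \<open>_ \<le> _ * \<beta>1\<close> mult_left_mono[OF Bt, of "C + D / 2 - G"] by linarith
    then have "\<gamma> * (C + D) * p t \<le> (C + D / 2 - G) * B t * p t"
      using p_pos[of t] by (intro mult_right_mono) auto
    then show "- (B t * m) \<le> u' t"
      using x't by (simp add: u'_def algebra_simps)
  qed (use B B_int in auto)
  then show ?thesis using sT by (simp add: u_def p_def)
qed

lemma delay_equation_abs_bound:
  fixes x x' B S h0 :: "real \<Rightarrow> real"
  assumes sT: "\<sigma> \<le> T" and N: "negligible N"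
    and x: "\<And>s t. \<sigma> \<le> s \<Longrightarrow> s \<le> t \<Longrightarrow> t \<le> T \<Longrightarrow> (x' has_integral (x t - x s)) {s..t}"
    and hist: "\<And>s. s \<le> \<sigma> \<Longrightarrow> \<bar>x s\<bar> \<le> J"
    and B: "B integrable_on {\<sigma>..T}"
    and B_bd: "\<And>t. t \<in> {\<sigma>..T} \<Longrightarrow> \<beta>1 \<le> B t \<and> B t \<le> \<beta>2" and \<beta>1: "\<beta>1 > 0"
    and B_int: "\<And>t. t \<in> {\<sigma>..T} \<Longrightarrow> integral {max \<sigma> (h0 t)..t} B \<le> 1 / exp 1"
    and S_ge: "\<And>t c. t \<in> {\<sigma>..T} \<Longrightarrow> (\<And>s. h0 t \<le> s \<Longrightarrow> s \<le> t \<Longrightarrow> c \<le> x s) \<Longrightarrow> c \<le> S t"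
    and S_le: "\<And>t c. t \<in> {\<sigma>..T} \<Longrightarrow> (\<And>s. h0 t \<le> s \<Longrightarrow> s \<le> t \<Longrightarrow> x s \<le> c) \<Longrightarrow> S t \<le> c"
    and f: "\<And>t. t \<in> {\<sigma>..T} - N \<Longrightarrow> \<bar>x' t + B t * S t\<bar> \<le> B t * (G * exp (- \<gamma> * (t - \<sigma>)))"
    and \<gamma>: "\<gamma> \<ge> 0" and C: "C \<ge> 0" and D: "D \<ge> 4 * J"
    and GCD: "G * \<beta>1 \<le> C * (\<beta>1 - \<gamma>) + D * (\<beta>1 / 2 - \<gamma>)"
  shows "\<bar>x T\<bar> \<le> (C + D) * exp (- \<gamma> * (T - \<sigma>))"
proof -
  have "x T \<le> (C + D) * exp (- \<gamma> * (T - \<sigma>))"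
    by (rule delay_equation_upper_bound[OF sT N x hist B B_bd \<beta>1 B_int S_ge _ \<gamma> C D GCD])
      (use f in fastforce)+
  moreover have "- x T \<le> (C + D) * exp (- \<gamma> * (T - \<sigma>))"
  proof (rule delay_equation_upper_bound[OF sT N _ _ B B_bd \<beta>1 B_int _ _ \<gamma> C D GCD,
        where x = "\<lambda>t. - x t" and x' = "\<lambda>t. - x' t" and S = "\<lambda>t. - S t"])
    show "((\<lambda>t. - x' t) has_integral (- x t - - x s)) {s..t}" if "\<sigma> \<le> s" "s \<le> t" "t \<le> T" for s t
      using has_integral_neg[OF x[OF that]] by simp
    show "c \<le> - S t" if "t \<in> {\<sigma>..T}" "\<And>s. h0 t \<le> s \<Longrightarrow> s \<le> t \<Longrightarrow> c \<le> - x s" for t c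
      using S_le[of t "- c"] that by fastforce
    show "- x' t + B t * - S t \<le> B t * (G * exp (- \<gamma> * (t - \<sigma>)))" if "t \<in> {\<sigma>..T} - N" for t
      using f[OF that] by simp
  qed (use hist in auto)
  ultimately show ?thesis by simp
qed

section \<open>The small-gain estimate on a finite interval\<close>

text \<open>\<open>X\<close> and \<open>Y\<close> are the best weighted bounds of \<open>x\<close> and \<open>x'\<close> on \<open>[\<sigma>, T]\<close>. The equation bounds
  \<open>Y\<close> by \<open>X\<close>, the comparison bounds \<open>X\<close> by \<open>X\<close> and \<open>Y\<close>, and the composition is a contraction
  up to a multiple of the size \<open>J\<close> of the history, uniformly in \<open>T\<close>.\<close>

lemma neutral_small_gain:
  fixes x x' B S h0 :: "real \<Rightarrow> real"
  defines "p \<equiv> \<lambda>\<sigma> \<gamma> t. exp (- \<gamma> * (t - \<sigma>))"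
  assumes sT: "\<sigma> \<le> T"
    and x: "\<And>s t. \<sigma> \<le> s \<Longrightarrow> s \<le> t \<Longrightarrow> t \<le> T \<Longrightarrow> (x' has_integral (x t - x s)) {s..t}"
    and hist: "\<And>s. s \<le> \<sigma> \<Longrightarrow> \<bar>x s\<bar> \<le> J"
    and x'_bd: "AE t in lebesgue. t \<in> {\<sigma>..T} \<longrightarrow> \<bar>x' t\<bar> \<le> Y1"
    and B: "B integrable_on {\<sigma>..T}"
    and B_bd: "\<And>t. t \<in> {\<sigma>..T} \<Longrightarrow> \<beta>1 \<le> B t \<and> B t \<le> \<beta>2" and \<beta>1: "\<beta>1 > 0"
    and B_int: "\<And>t. t \<in> {\<sigma>..T} \<Longrightarrow> integral {max \<sigma> (h0 t)..t} B \<le> 1 / exp 1"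
    and S_ge: "\<And>t c. t \<in> {\<sigma>..T} \<Longrightarrow> (\<And>s. h0 t \<le> s \<Longrightarrow> s \<le> t \<Longrightarrow> c \<le> x s) \<Longrightarrow> c \<le> S t"
    and S_le: "\<And>t c. t \<in> {\<sigma>..T} \<Longrightarrow> (\<And>s. h0 t \<le> s \<Longrightarrow> s \<le> t \<Longrightarrow> x s \<le> c) \<Longrightarrow> S t \<le> c"
    and x'_step: "\<And>X Y. 0 \<le> X \<Longrightarrow> 0 \<le> Y \<Longrightarrow> (\<And>s. s \<le> T \<Longrightarrow> \<bar>x s\<bar> \<le> X * p \<sigma> \<gamma> s) \<Longrightarrow>
        AE t in lebesgue. t \<in> {\<sigma>..T} \<longrightarrow> \<bar>x' t\<bar> \<le> Y * p \<sigma> \<gamma> t \<Longrightarrow>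
        AE t in lebesgue. t \<in> {\<sigma>..T} \<longrightarrow> \<bar>x' t\<bar> \<le> \<rho> * (A * (Y + J) + Bn * X) * p \<sigma> \<gamma> t"
    and f_step: "\<And>X Y. 0 \<le> X \<Longrightarrow> 0 \<le> Y \<Longrightarrow> (\<And>s. s \<le> T \<Longrightarrow> \<bar>x s\<bar> \<le> X * p \<sigma> \<gamma> s) \<Longrightarrow>
        AE t in lebesgue. t \<in> {\<sigma>..T} \<longrightarrow> \<bar>x' t\<bar> \<le> Y * p \<sigma> \<gamma> t \<Longrightarrow>
        AE t in lebesgue. t \<in> {\<sigma>..T} \<longrightarrow>
          \<bar>x' t + B t * S t\<bar> \<le> B t * (\<rho> * (A1 * (Y + J) + A2 * X + E * J) * p \<sigma> \<gamma> t)"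
    and nn: "A \<ge> 0" "Bn \<ge> 0" "A1 \<ge> 0" "A2 \<ge> 0" "E \<ge> 0" "\<rho> \<ge> 0"
    and \<gamma>: "\<gamma> \<ge> 0" "4 * \<gamma> \<le> \<beta>1" and \<rho>A: "\<rho> * A < 1"
    and \<kappa>: "\<kappa> = \<rho> * (A1 * (\<rho> * Bn / (1 - \<rho> * A)) + A2) * (\<beta>1 / (\<beta>1 - \<gamma>))" "\<kappa> < 1"
  shows "\<bar>x T\<bar> \<le> (\<rho> * (\<beta>1 / (\<beta>1 - \<gamma>)) * A1 * (\<rho> * (A + Bn) / (1 - \<rho> * A)) + 4 * (1 + \<rho> * (A1 + A2 + E)))
      / (1 - \<kappa>) * J * exp (- \<gamma> * (T - \<sigma>))"
proof -
  define P where "P = p \<sigma> \<gamma>"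
  have P_pos: "P t > 0" for t by (simp add: P_def p_def)
  have P_inv: "P t * exp (\<gamma> * (t - \<sigma>)) = 1" for t by (simp add: P_def p_def mult_exp_exp)
  have P_ge1: "1 \<le> P s" if "s \<le> \<sigma>" for s
    using that \<gamma> by (simp add: P_def p_def mult_nonneg_nonpos)
  have J: "J \<ge> 0" using hist[of \<sigma>] by auto
  have x_cont: "continuous_on {\<sigma>..T} x" by (rule continuous_on_primitive[OF x])
  obtain tX where tX: "tX \<in> {\<sigma>..T}" and
    max: "\<And>t. t \<in> {\<sigma>..T} \<Longrightarrow> \<bar>x t\<bar> * exp (\<gamma> * (t - \<sigma>)) \<le> \<bar>x tX\<bar> * exp (\<gamma> * (tX - \<sigma>))"
  proof -
    have "\<exists>t\<in>{\<sigma>..T}. \<forall>s\<in>{\<sigma>..T}. \<bar>x s\<bar> * exp (\<gamma> * (s - \<sigma>)) \<le> \<bar>x t\<bar> * exp (\<gamma> * (t - \<sigma>))"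
      by (rule continuous_attains_sup) (use sT in \<open>auto intro!: continuous_intros x_cont\<close>)
    then show thesis using that by blast
  qed
  define X where "X = \<bar>x tX\<bar> * exp (\<gamma> * (tX - \<sigma>))"
  have X0: "X \<ge> 0" by (simp add: X_def)
  have xX: "\<bar>x t\<bar> \<le> X * P t" if "t \<in> {\<sigma>..T}" for t
  proof -
    have "\<bar>x t\<bar> = \<bar>x t\<bar> * exp (\<gamma> * (t - \<sigma>)) * P t"
      using P_inv[of t] by (simp add: mult.assoc mult.commute[of _ "P t"])
    also have "\<dots> \<le> X * P t"
      unfolding X_def using max[OF that] P_pos[of t] by (intro mult_right_mono) auto
    finally show ?thesis .
  qed
  have xXJ: "\<bar>x s\<bar> \<le> (X + J) * P s" if "s \<le> T" for s
  proof (cases "\<sigma> \<le> s")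
    case True
    have "X * P s \<le> (X + J) * P s" using J P_pos[of s] by (intro mult_right_mono) auto
    then show ?thesis using xX[of s] True that by auto
  next
    case False
    have "\<bar>x s\<bar> \<le> J * 1" using hist[of s] False by simp
    also have "\<dots> \<le> (X + J) * P s" by (rule mult_mono) (use X0 J P_ge1[of s] False in auto)
    finally show ?thesis .
  qed
  \<comment> \<open>The infimum of the admissible bounds is admissible too, because countably many
    null sets are discarded. The a priori bound \<open>Y1\<close> serves only to make
    \<open>W\<close> nonempty, so it leaves no trace in the final constant.\<close>
  define W where "W = {Y. 0 \<le> Y \<and> (AE t in lebesgue. t \<in> {\<sigma>..T} \<longrightarrow> \<bar>x' t\<bar> \<le> Y * P t)}"
  define Y where "Y = Inf W"
  have W_bdd: "bdd_below W" by (rule bdd_belowI[of _ 0]) (simp add: W_def)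
  have "\<bar>Y1\<bar> * exp (\<gamma> * (T - \<sigma>)) \<in> W"
    unfolding W_def
  proof (intro CollectI conjI, simp, use x'_bd in eventually_elim, intro impI)
    fix t assume "t \<in> {\<sigma>..T} \<longrightarrow> \<bar>x' t\<bar> \<le> Y1" and t: "t \<in> {\<sigma>..T}"
    then have "\<bar>x' t\<bar> \<le> \<bar>Y1\<bar> * (exp (\<gamma> * (t - \<sigma>)) * P t)"
      using P_inv[of t] by (simp add: mult.commute)
    also have "\<dots> \<le> \<bar>Y1\<bar> * (exp (\<gamma> * (T - \<sigma>)) * P t)"
      using t \<gamma> P_pos[of t] by (intro mult_left_mono mult_right_mono) (auto intro!: mult_left_mono)
    finally show "\<bar>x' t\<bar> \<le> \<bar>Y1\<bar> * exp (\<gamma> * (T - \<sigma>)) * P t" by (simp add: mult.assoc)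
  qed
  then have W_ne: "W \<noteq> {}" by auto
  have Y0: "Y \<ge> 0" unfolding Y_def by (rule cInf_greatest[OF W_ne]) (simp add: W_def)
  have Y_AE: "AE t in lebesgue. t \<in> {\<sigma>..T} \<longrightarrow> \<bar>x' t\<bar> \<le> Y * P t"
  proof -
    have "\<forall>n. AE t in lebesgue. t \<in> {\<sigma>..T} \<longrightarrow> \<bar>x' t\<bar> \<le> (Y + 1 / real (Suc n)) * P t"
    proof
      fix n
      obtain y where y: "y \<in> W" "y < Y + 1 / real (Suc n)"
        using cInf_lessD[OF W_ne, of "Y + 1 / real (Suc n)"] by (auto simp: Y_def)
      then have "AE t in lebesgue. t \<in> {\<sigma>..T} \<longrightarrow> \<bar>x' t\<bar> \<le> y * P t" by (simp add: W_def)
      then show "AE t in lebesgue. t \<in> {\<sigma>..T} \<longrightarrow> \<bar>x' t\<bar> \<le> (Y + 1 / real (Suc n)) * P t"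
      proof eventually_elim
        case (elim t)
        have "y * P t \<le> (Y + 1 / real (Suc n)) * P t"
          using y P_pos[of t] by (intro mult_right_mono) auto
        then show ?case using elim by auto
      qed
    qed
    then have "AE t in lebesgue. \<forall>n. t \<in> {\<sigma>..T} \<longrightarrow> \<bar>x' t\<bar> \<le> (Y + 1 / real (Suc n)) * P t"
      unfolding AE_all_countable by blast
    then show ?thesis
    proof eventually_elim
      case (elim t)
      have "(\<lambda>n. (Y + 1 / real (Suc n)) * P t) \<longlonglongrightarrow> (Y + 0) * P t"
        by (intro tendsto_intros LIMSEQ_Suc[OF lim_1_over_n])
      then show ?case using elim by (auto intro!: LIMSEQ_le_const)
    qed
  qed
  have XJ0: "0 \<le> X + J" using X0 J by simp
  \<comment> \<open>The improved bound is again admissible, hence not below the infimum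
    \<open>Y\<close>. This turns the implication \<open>x'_step\<close> into an inequality that can
    be solved for \<open>Y\<close> because \<open>\<rho> * A < 1\<close>.\<close>
  have "\<rho> * (A * (Y + J) + Bn * (X + J)) \<in> W"
    using x'_step[OF XJ0 Y0] xXJ Y_AE nn Y0 J XJ0 by (simp add: W_def P_def)
  then have "Y \<le> \<rho> * (A * (Y + J) + Bn * (X + J))"
    unfolding Y_def[symmetric] by (metis Y_def cInf_lower[OF _ W_bdd])
  then have "(1 - \<rho> * A) * Y \<le> \<rho> * (A + Bn) * J + \<rho> * Bn * X" by (simp add: algebra_simps)
  then have Y_le: "Y \<le> (\<rho> * (A + Bn) * J + \<rho> * Bn * X) / (1 - \<rho> * A)"
    using \<rho>A by (simp add: pos_le_divide_eq mult.commute)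
  define \<theta> where "\<theta> = \<beta>1 / (\<beta>1 - \<gamma>)"
  have \<theta>: "\<theta> \<ge> 0" "\<theta> * (\<beta>1 - \<gamma>) = \<beta>1" using \<beta>1 \<gamma> by (auto simp: \<theta>_def)
  \<comment> \<open>\<open>C\<close> is chosen so that \<open>C * (\<beta>1 - \<gamma>)\<close>
    matches exactly the part of \<open>G * \<beta>1\<close> that contains \<open>X\<close> and
    \<open>Y\<close>; \<open>D\<close> takes the multiples of \<open>J\<close>. Since
    \<open>4 * \<gamma> \<le> \<beta>1\<close>, the coefficient
    \<open>\<beta>1 / 2 - \<gamma>\<close> is at least \<open>\<beta>1 / 4\<close>, which explains
    the factor 4. The summand 1 in \<open>D\<close> ensures \<open>D \<ge> 4 * J\<close>.\<close>
  define C where "C = \<rho> * (A1 * Y + A2 * X) * \<theta>"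
  define D where "D = 4 * (1 + \<rho> * (A1 + A2 + E)) * J"
  define G where "G = \<rho> * (A1 * (Y + J) + A2 * (X + J) + E * J)"
  have C0: "C \<ge> 0" using nn Y0 X0 \<theta> by (simp add: C_def)
  have D4: "D \<ge> 4 * J" using nn J by (simp add: D_def mult_right_mono)
  have GCD: "G * \<beta>1 \<le> C * (\<beta>1 - \<gamma>) + D * (\<beta>1 / 2 - \<gamma>)"
  proof -
    have "C * (\<beta>1 - \<gamma>) = \<rho> * (A1 * Y + A2 * X) * \<beta>1"
      using \<theta>(2) by (simp add: C_def mult.assoc)
    moreover have "D * (\<beta>1 / 4) \<le> D * (\<beta>1 / 2 - \<gamma>)"
      using \<gamma> D4 J by (intro mult_left_mono) auto
    moreover have "D * (\<beta>1 / 4) = J * \<beta>1 + \<rho> * (A1 + A2 + E) * J * \<beta>1"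
      by (simp add: D_def algebra_simps)
    moreover have "G * \<beta>1 = \<rho> * (A1 * Y + A2 * X) * \<beta>1 + \<rho> * (A1 + A2 + E) * J * \<beta>1"
      by (simp add: G_def algebra_simps)
    moreover have "J * \<beta>1 \<ge> 0" using J \<beta>1 by simp
    ultimately show ?thesis by linarith
  qed
  have "AE t in lebesgue. t \<in> {\<sigma>..T} \<longrightarrow> \<bar>x' t + B t * S t\<bar> \<le> B t * (G * P t)"
    using f_step[OF XJ0 Y0] xXJ Y_AE by (simp add: P_def G_def)
  then obtain N where N: "N \<in> null_sets lebesgue"
    and fN: "{t. \<not> (t \<in> {\<sigma>..T} \<longrightarrow> \<bar>x' t + B t * S t\<bar> \<le> B t * (G * P t))} \<subseteq> N"
    unfolding eventually_ae_filter by auto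
  have CD: "\<bar>x t\<bar> \<le> (C + D) * P t" if t: "t \<in> {\<sigma>..T}" for t
    unfolding P_def p_def
  proof (rule delay_equation_abs_bound[where B = B and S = S and G = G and N = N
        and x' = x' and ?\<beta>1.0 = \<beta>1 and ?\<beta>2.0 = \<beta>2 and ?h0.0 = h0 and J = J])
    show "negligible N" using N negligible_iff_null_sets by blast
    show "B integrable_on {\<sigma>..t}" by (rule integrable_on_subinterval[OF B]) (use t in auto)
    show "\<bar>x' r + B r * S r\<bar> \<le> B r * (G * exp (- \<gamma> * (r - \<sigma>)))" if "r \<in> {\<sigma>..t} - N" for r
      using fN that t by (auto simp: P_def p_def)
  qed (use t x hist B_bd \<beta>1 B_int S_ge S_le \<gamma> C0 D4 GCD in auto)
  \<comment> \<open>At the point \<open>tX\<close> where the weighted maximum is attained, the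
    pointwise bound becomes a bound of \<open>X\<close> by itself.\<close>
  have "X \<le> (C + D) * (P tX * exp (\<gamma> * (tX - \<sigma>)))"
    using mult_right_mono[OF CD[OF tX], of "exp (\<gamma> * (tX - \<sigma>))"] by (simp add: X_def mult.assoc)
  then have "X \<le> C + D" using P_inv by simp
  also have "C \<le> \<rho> * (A1 * ((\<rho> * (A + Bn) * J + \<rho> * Bn * X) / (1 - \<rho> * A)) + A2 * X) * \<theta>"
    unfolding C_def using Y_le nn \<theta> by (intro mult_right_mono mult_left_mono add_right_mono) auto
  finally have "X \<le> \<kappa> * X + (\<rho> * \<theta> * A1 * (\<rho> * (A + Bn) / (1 - \<rho> * A)) + 4 * (1 + \<rho> * (A1 + A2 + E))) * J"
    unfolding \<kappa> \<theta>_def[symmetric] D_def by (simp add: algebra_simps add_divide_distrib)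
  then have "X * (1 - \<kappa>) \<le> (\<rho> * \<theta> * A1 * (\<rho> * (A + Bn) / (1 - \<rho> * A)) + 4 * (1 + \<rho> * (A1 + A2 + E))) * J"
    by (simp add: algebra_simps)
  then have "X \<le> (\<rho> * \<theta> * A1 * (\<rho> * (A + Bn) / (1 - \<rho> * A)) + 4 * (1 + \<rho> * (A1 + A2 + E))) * J / (1 - \<kappa>)"
    using \<kappa>(2) by (simp add: pos_le_divide_eq)
  then have "X * P T \<le> (\<rho> * \<theta> * A1 * (\<rho> * (A + Bn) / (1 - \<rho> * A)) + 4 * (1 + \<rho> * (A1 + A2 + E))) * J / (1 - \<kappa>) * P T"
    using P_pos[of T] by (intro mult_right_mono) auto
  then show ?thesis using xX[of T] sT unfolding \<theta>_def P_def p_def by simp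
qed

section \<open>Kernel averages and bounds from almost everywhere estimates\<close>

lemma set_integrable_mult_bounded:
  fixes k f :: "real \<Rightarrow> real"
  assumes k: "set_integrable lebesgue I k" and f: "f \<in> borel_measurable borel"
    and M: "\<And>s. \<bar>f s\<bar> \<le> M"
  shows "set_integrable lebesgue I (\<lambda>s. k s * f s)"
  unfolding set_integrable_def
proof (rule Bochner_Integration.integrable_bound)
  show "integrable lebesgue (\<lambda>s. M * \<bar>indicator I s *\<^sub>R k s\<bar>)"
    using k unfolding set_integrable_def by auto
  have "f \<in> borel_measurable lebesgue" using f by (intro measurable_completion) simp
  moreover have "(\<lambda>s. indicator I s *\<^sub>R k s) \<in> borel_measurable lebesgue"
    using k unfolding set_integrable_def by auto
  ultimately have "(\<lambda>s. (indicator I s *\<^sub>R k s) * f s) \<in> borel_measurable lebesgue" by measurable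
  then show "(\<lambda>s. indicator I s *\<^sub>R (k s * f s)) \<in> borel_measurable lebesgue" by (simp add: mult.assoc)
  have "\<bar>indicator I s *\<^sub>R k s\<bar> * \<bar>f s\<bar> \<le> \<bar>indicator I s *\<^sub>R k s\<bar> * M" for s
    by (rule mult_left_mono[OF M]) auto
  then show "AE s in lebesgue. norm (indicator I s *\<^sub>R (k s * f s)) \<le> norm (M * \<bar>indicator I s *\<^sub>R k s\<bar>)"
    using order_trans[OF abs_ge_zero M]
    by (auto simp: abs_mult mult_ac)
qed

text \<open>Source of the mean value property of kernel averages and, with bounds of both signs, of
  the absolute estimates of delay terms. The global bound \<open>M\<close> is there for
  integrability; the constant \<open>c\<close> has to be a bound on \<open>I\<close> only.\<close>

lemma set_lebesgue_integral_weighted_bounds: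
  fixes k f :: "real \<Rightarrow> real"
  assumes k: "set_integrable lebesgue I k" and k_nn: "\<And>s. s \<in> I \<Longrightarrow> 0 \<le> k s"
    and f: "f \<in> borel_measurable borel" and M: "\<And>s. \<bar>f s\<bar> \<le> M"
  shows "(\<And>s. s \<in> I \<Longrightarrow> c \<le> f s) \<Longrightarrow> c * (LINT s:I|lebesgue. k s) \<le> (LINT s:I|lebesgue. k s * f s)"
    and "(\<And>s. s \<in> I \<Longrightarrow> f s \<le> c) \<Longrightarrow> (LINT s:I|lebesgue. k s * f s) \<le> c * (LINT s:I|lebesgue. k s)"
proof -
  note kf = set_integrable_mult_bounded[OF k f M]
  have kc: "set_integrable lebesgue I (\<lambda>s. c * k s)" using k by simp
  show "c * (LINT s:I|lebesgue. k s) \<le> (LINT s:I|lebesgue. k s * f s)" if "\<And>s. s \<in> I \<Longrightarrow> c \<le> f s"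
    unfolding set_integral_mult_right[symmetric]
    by (rule set_integral_mono[OF kc kf]) (use that k_nn in \<open>auto simp: mult.commute[of c] intro: mult_left_mono\<close>)
  show "(LINT s:I|lebesgue. k s * f s) \<le> c * (LINT s:I|lebesgue. k s)" if "\<And>s. s \<in> I \<Longrightarrow> f s \<le> c"
    unfolding set_integral_mult_right[symmetric]
    by (rule set_integral_mono[OF kf kc]) (use that k_nn in \<open>auto simp: mult.commute[of c] intro: mult_left_mono\<close>)
qed

text \<open>It turns an almost everywhere bound of the derivative into a Lipschitz estimate, which
  measures the cost of shifting the argument when a delay is truncated.\<close>

lemma has_integral_AE_bound:
  fixes u u' :: "real \<Rightarrow> real"
  assumes u: "(u' has_integral i) {s..t}" and st: "s \<le> t" and c: "c \<ge> 0"
    and AE: "AE r in lebesgue. r \<in> {s..t} \<longrightarrow> \<bar>u' r\<bar> \<le> c"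
  shows "\<bar>i\<bar> \<le> c * (t - s)"
proof -
  obtain N where N: "N \<in> null_sets lebesgue" "{r. \<not> (r \<in> {s..t} \<longrightarrow> \<bar>u' r\<bar> \<le> c)} \<subseteq> N"
    using AE unfolding eventually_ae_filter by auto
  define F where "F r = (if r \<in> N then 0 else u' r)" for r
  have "negligible N" using N(1) negligible_iff_null_sets by blast
  then have "(F has_integral i) {s..t}"
    by (rule has_integral_spike[OF _ _ u]) (auto simp: F_def)
  moreover have "norm (F r) \<le> c" if "r \<in> {s..t} - {}" for r
    using that N c by (auto simp: F_def)
  ultimately have "norm i \<le> c * measure lborel {s..t}"
    using has_integral_bound_real[OF c finite.emptyI] by blast
  then show ?thesis using st by simp
qed

section \<open>Exponential stability from a comparison coefficient and a truncated delay\<close>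

text \<open>\<open>B\<close> and \<open>h0\<close> are left free so that the three conditions become
  three choices of them. Relative to \<open>B\<close>, the constant \<open>A1\<close> measures the
  neutral term, \<open>A1'\<close> the truncation of the delay from \<open>h\<close> to
  \<open>h0\<close>, and \<open>A2\<close> the replacement of \<open>b\<close> by \<open>B\<close>.
  The equation bounds x' by x with gain \<open>Bn / (1 - A)\<close>; x' acts back on x with gain
  \<open>A1 + A1'\<close>, and x acts directly on itself with gain \<open>A2\<close>.
  \<open>small\<close> says that this loop contracts for exponent zero.\<close>

lemma neutral_exponentially_stable:
  fixes a g h b B h0 :: "real \<Rightarrow> real" and K :: "real \<Rightarrow> real \<Rightarrow> real"
  assumes t0_nonneg: "t0 \<ge> 0"
    and K_nonneg: "\<And>t s. t \<ge> 0 \<Longrightarrow> s \<ge> 0 \<Longrightarrow> K t s \<ge> 0"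
    and b_eq: "\<And>t. t \<ge> t0 \<Longrightarrow> b t = (LINT s:{h t..t}|lebesgue. kernel_ext K t s)"
    and b_pos: "\<And>t. t \<ge> t0 \<Longrightarrow> b t > 0"
    and g_le: "\<And>t. t \<ge> t0 \<Longrightarrow> g t \<le> t"
    and g_null: "\<And>E. E \<in> null_sets lebesgue \<Longrightarrow> {t \<in> {0..}. g t \<in> E} \<in> null_sets lebesgue"
    and g_delay: "\<And>t. t \<ge> t0 \<Longrightarrow> t - g t \<le> \<Delta>"
    and h_delay: "\<And>t. t \<ge> t0 \<Longrightarrow> t - h t \<le> \<Delta>"
    and h0: "\<And>t. t \<ge> t0 \<Longrightarrow> h t \<le> h0 t \<and> h0 t \<le> t"
    and B_bd: "\<And>t. t \<ge> t0 \<Longrightarrow> \<beta>1 \<le> B t \<and> B t \<le> \<beta>2" and \<beta>1: "\<beta>1 > 0"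
    and B: "\<And>T. B integrable_on {t0..T}"
    and B_int: "\<And>\<sigma> t. t0 \<le> \<sigma> \<Longrightarrow> \<sigma> \<le> t \<Longrightarrow> integral {max \<sigma> (h0 t)..t} B \<le> 1 / exp 1"
    and AE_a: "AE t in lebesgue. t \<ge> t0 \<longrightarrow> \<bar>a t\<bar> \<le> A"
    and AE_b: "AE t in lebesgue. t \<ge> t0 \<longrightarrow> b t \<le> Bn"
    and AE_aB: "AE t in lebesgue. t \<ge> t0 \<longrightarrow> \<bar>a t\<bar> \<le> A1 * B t"
    and AE_h: "AE t in lebesgue. t \<ge> t0 \<longrightarrow> b t * (h0 t - h t) \<le> A1' * B t"
    and AE_bB: "AE t in lebesgue. t \<ge> t0 \<longrightarrow> B t \<le> b t \<and> b t - B t \<le> A2 * B t"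
    and nn: "A \<ge> 0" "Bn \<ge> 0" "A1 \<ge> 0" "A1' \<ge> 0" "A2 \<ge> 0"
    and A: "A < 1" and small: "(A1 + A1') * (Bn / (1 - A)) + A2 < 1"
  shows "exponentially_stable t0 a g h K"
proof -
  have \<Delta>: "\<Delta> \<ge> 0" using g_delay[of t0] g_le[of t0] by simp
  \<comment> \<open>The loop gain with weight exponent \<open>\<gamma>\<close>. It is continuous at
    0, where it equals the left-hand side of \<open>small\<close>.\<close>
  let ?\<kappa> = "\<lambda>\<gamma>. exp (\<gamma> * \<Delta>) * ((A1 + A1') * (exp (\<gamma> * \<Delta>) * Bn / (1 - exp (\<gamma> * \<Delta>) * A)) + A2) * (\<beta>1 / (\<beta>1 - \<gamma>))"
  obtain \<gamma> where \<gamma>: "\<gamma> > 0" "4 * \<gamma> < \<beta>1" "exp (\<gamma> * \<Delta>) * A < 1" "?\<kappa> \<gamma> < 1"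
  proof -
    have "eventually (\<lambda>\<gamma>. 4 * \<gamma> < \<beta>1) (at_right 0)"
      by (rule order_tendstoD(2)[where y = "4 * 0"]) (use \<beta>1 in \<open>auto intro!: tendsto_eq_intros\<close>)
    moreover have "eventually (\<lambda>\<gamma>. exp (\<gamma> * \<Delta>) * A < 1) (at_right 0)"
      by (rule order_tendstoD(2)[where y = "exp (0 * \<Delta>) * A"]) (use A in \<open>auto intro!: tendsto_eq_intros\<close>)
    moreover have "eventually (\<lambda>\<gamma>. ?\<kappa> \<gamma> < 1) (at_right 0)"
    proof (rule order_tendstoD(2))
      show "(?\<kappa> \<longlongrightarrow> ?\<kappa> 0) (at_right 0)"
        by (intro tendsto_intros) (use A \<beta>1 in auto)
    qed (use small \<beta>1 in simp)
    moreover have "eventually (\<lambda>\<gamma>::real. \<gamma> > 0) (at_right 0)" by (rule eventually_at_right_less)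
    ultimately have "eventually (\<lambda>\<gamma>. \<gamma> > 0 \<and> 4 * \<gamma> < \<beta>1 \<and> exp (\<gamma> * \<Delta>) * A < 1 \<and> ?\<kappa> \<gamma> < 1) (at_right 0)"
      by eventually_elim simp
    then show thesis using that eventually_happens'[OF trivial_limit_at_right_real] by blast
  qed
  define \<rho> where "\<rho> = exp (\<gamma> * \<Delta>)"
  have \<rho>: "\<rho> \<ge> 1" "\<rho> \<ge> 0" using \<Delta> \<gamma> by (auto simp: \<rho>_def)
  \<comment> \<open>Two history values differ by at most \<open>2 * J\<close>, and the kernel mass
    \<open>b\<close> is at most \<open>(1 + A2) * B\<close>.\<close>
  define E where "E = 2 * (1 + A2)"
  define \<kappa> where "\<kappa> = ?\<kappa> \<gamma>"
  define M where "M = (\<rho> * (\<beta>1 / (\<beta>1 - \<gamma>)) * (A1 + A1') * (\<rho> * (A + Bn) / (1 - \<rho> * A)) +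
      4 * (1 + \<rho> * (A1 + A1' + A2 + E))) / (1 - \<kappa>)"
  \<comment> \<open>The integral of a non-integrable function is 0 by default, so positivity of
    \<open>b t\<close> already yields integrability of the kernel section, for every
    \<open>t \<ge> t0\<close> and not just almost every one.\<close>
  have K_int: "set_integrable lebesgue {h t..t} (kernel_ext K t)" if "t \<ge> t0" for t
    using b_pos[OF that] not_integrable_integral_eq[of lebesgue "\<lambda>s. indicator {h t..t} s *\<^sub>R kernel_ext K t s"]
    unfolding b_eq[OF that] set_lebesgue_integral_def set_integrable_def by fastforce
  have K_nn: "0 \<le> kernel_ext K t s" if "t \<ge> t0" for t s
    using K_nonneg[of t s] that t0_nonneg by (simp add: kernel_ext_def)
  have main: "\<bar>x T\<bar> \<le> M * J * exp (- \<gamma> * (T - \<sigma>))"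
    if s0: "\<sigma> \<ge> t0" and sT: "\<sigma> \<le> T" and init: "initial_data \<sigma> \<phi> \<psi>"
      and sol: "neutral_solution a g h K \<sigma> \<phi> \<psi> x"
      and \<phi>J: "\<And>s. s \<le> \<sigma> \<Longrightarrow> \<bar>\<phi> s\<bar> \<le> J" and \<psi>J: "\<And>s. s < \<sigma> \<Longrightarrow> \<bar>\<psi> s\<bar> \<le> J"
    for \<sigma> T \<phi> \<psi> x J
  proof -
    define P where "P t = exp (- \<gamma> * (t - \<sigma>))" for t
    have P_pos: "P t > 0" for t by (simp add: P_def)
    have P_mono: "P t \<le> P s" if "s \<le> t" for s t using that \<gamma> by (simp add: P_def mult_left_mono)
    have P_ge1: "1 \<le> P s" if "s \<le> \<sigma>" for s
      using that \<gamma> by (simp add: P_def mult_nonneg_nonpos)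
    have P_delay: "P s \<le> \<rho> * P t" if "t - s \<le> \<Delta>" for s t
    proof -
      have "\<gamma> * (t - s) \<le> \<gamma> * \<Delta>" using that \<gamma> by (intro mult_left_mono) auto
      then show ?thesis by (simp add: P_def \<rho>_def mult_exp_exp algebra_simps)
    qed
    have J: "J \<ge> 0" using \<phi>J[of \<sigma>] by auto
    have x_hist: "x s = \<phi> s" if "s \<le> \<sigma>" for s using sol that by (simp add: neutral_solution_def)
    define d where "d = deriv_hist \<sigma> \<psi> x"
    have AC: "absolutely_continuous_fun_on \<sigma> T x" using sol sT by (simp add: neutral_solution_def)
    obtain Y1 where "AE t in lebesgue_on {\<sigma>..T}. x differentiable (at t within {\<sigma>..}) \<and>
        \<bar>vector_derivative x (at t within {\<sigma>..})\<bar> \<le> Y1"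
      using sol sT unfolding neutral_solution_def by blast
    then have "AE t in lebesgue. t \<in> {\<sigma>..T} \<longrightarrow> x differentiable (at t within {\<sigma>..}) \<and>
        \<bar>vector_derivative x (at t within {\<sigma>..})\<bar> \<le> Y1"
      by (subst (asm) AE_restrict_space_iff) auto
    then have AEd: "AE t in lebesgue. t \<in> {\<sigma>..T} \<longrightarrow>
        (x has_vector_derivative d t) (at t within {\<sigma>..}) \<and> \<bar>d t\<bar> \<le> Y1"
      by eventually_elim (auto simp: d_def deriv_hist_def vector_derivative_works)
    then obtain N where N: "N \<in> null_sets lebesgue" and
      NN: "{t. \<not> (t \<in> {\<sigma>..T} \<longrightarrow> (x has_vector_derivative d t) (at t within {\<sigma>..}) \<and> \<bar>d t\<bar> \<le> Y1)} \<subseteq> N"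
      unfolding eventually_ae_filter by auto
    have NN: "(x has_vector_derivative d t) (at t within {\<sigma>..})" if "t \<in> {\<sigma>..T}" "t \<notin> N" for t
      using NN that by blast
    have dx: "(d has_integral (x t - x s)) {s..t}" if st: "\<sigma> \<le> s" "s \<le> t" "t \<le> T" for s t
    proof (rule fundamental_theorem_of_calculus_absolutely_continuous[OF st(2)])
      show "absolutely_continuous_fun_on s t x"
        by (rule absolutely_continuous_fun_on_subset[OF AC]) (use st in auto)
      show "negligible N" using N negligible_iff_null_sets by blast
      show "(x has_vector_derivative d r) (at r within {s..t})" if "r \<in> {s..t} - N" for r
        by (rule has_vector_derivative_within_subset[of _ _ _ "{\<sigma>..}"]) (use NN that st in auto)
    qed
    have x_cont: "continuous_on {\<sigma>..T} x" by (rule continuous_on_primitive[OF dx])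
    \<comment> \<open>\<open>y\<close> agrees with \<open>x\<close> up to \<open>T\<close>, but is
      Borel measurable and bounded on the whole line, as the lemmas on kernel averages
      require.\<close>
    define y where "y s = (if s \<le> \<sigma> then \<phi> s else x (max \<sigma> (min s T)))" for s
    have y_x: "y s = x s" if "s \<le> T" for s using that x_hist by (simp add: y_def)
    have y_meas: "y \<in> borel_measurable borel"
    proof -
      have "continuous_on UNIV (\<lambda>s. x (max \<sigma> (min s T)))"
        by (rule continuous_on_compose2[OF x_cont]) (use sT in \<open>auto intro!: continuous_intros\<close>)
      then have 1: "(\<lambda>s. x (max \<sigma> (min s T))) \<in> borel_measurable borel"
        by (rule borel_measurable_continuous_onI)
      have 2: "\<phi> \<in> borel_measurable (restrict_space borel {s. s \<le> \<sigma>})"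
        using init by (simp add: initial_data_def atMost_def)
      show ?thesis
        unfolding y_def[abs_def]
        by (subst measurable_If_restrict_space_iff)
          (use 2 measurable_restrict_space1[OF 1] in auto)
    qed
    obtain My where My: "\<And>s. \<bar>y s\<bar> \<le> My"
    proof -
      have "bounded (x ` {\<sigma>..T})"
        by (intro compact_imp_bounded compact_continuous_image x_cont) auto
      then obtain c where "\<forall>s\<in>{\<sigma>..T}. \<bar>x s\<bar> \<le> c" unfolding bounded_iff by auto
      then have c: "\<bar>x s\<bar> \<le> c" if "s \<in> {\<sigma>..T}" for s using that by blast
      show thesis
        by (rule that[of "max J c"]) (use \<phi>J c sT in \<open>auto simp: y_def le_max_iff_disj\<close>)
    qed
    define L where "L t = (LINT s:{h t..t}|lebesgue. kernel_ext K t s * y s)" for t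
    \<comment> \<open>The kernel divided by \<open>b t\<close> is a probability density on the full
      delay interval. Moving arguments below \<open>h0 t\<close> up to \<open>h0 t\<close> makes
      \<open>S t\<close> an average of values of \<open>x\<close> on the truncated interval; for
      \<open>h0 = h\<close> it is the original delay term divided by \<open>b t\<close>.\<close>
    define S where "S t = (LINT s:{h t..t}|lebesgue. kernel_ext K t s * y (max s (h0 t))) / b t" for t
    have ym_meas: "(\<lambda>s. y (max s (h0 t))) \<in> borel_measurable borel" for t
      using y_meas by measurable
    have L_int: "set_integrable lebesgue {h t..t} (\<lambda>s. kernel_ext K t s * y s)" if "t \<ge> t0" for t
      by (rule set_integrable_mult_bounded[OF K_int[OF that] y_meas My])
    have S_int: "set_integrable lebesgue {h t..t} (\<lambda>s. kernel_ext K t s * y (max s (h0 t)))" if "t \<ge> t0" for t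
      by (rule set_integrable_mult_bounded[OF K_int[OF that] ym_meas My])
    have S_ge: "c \<le> S t" if t: "t \<in> {\<sigma>..T}" and c: "\<And>s. h0 t \<le> s \<Longrightarrow> s \<le> t \<Longrightarrow> c \<le> x s" for t c
    proof -
      have t0: "t \<ge> t0" using t s0 by auto
      have "c * b t \<le> (LINT s:{h t..t}|lebesgue. kernel_ext K t s * y (max s (h0 t)))"
        unfolding b_eq[OF t0]
        by (rule set_lebesgue_integral_weighted_bounds(1)[OF K_int[OF t0] K_nn[OF t0] ym_meas My])
          (use t h0[OF t0] in \<open>auto simp: y_x intro!: c\<close>)
      then show ?thesis using b_pos[OF t0] by (simp add: S_def pos_le_divide_eq)
    qed
    have S_le: "S t \<le> c" if t: "t \<in> {\<sigma>..T}" and c: "\<And>s. h0 t \<le> s \<Longrightarrow> s \<le> t \<Longrightarrow> x s \<le> c" for t c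
    proof -
      have t0: "t \<ge> t0" using t s0 by auto
      have "(LINT s:{h t..t}|lebesgue. kernel_ext K t s * y (max s (h0 t))) \<le> c * b t"
        unfolding b_eq[OF t0]
        by (rule set_lebesgue_integral_weighted_bounds(2)[OF K_int[OF t0] K_nn[OF t0] ym_meas My])
          (use t h0[OF t0] in \<open>auto simp: y_x intro!: c\<close>)
      then show ?thesis using b_pos[OF t0] by (simp add: S_def pos_divide_le_eq)
    qed
    have eq: "AE t in lebesgue. t \<in> {\<sigma>..T} \<longrightarrow> d t = a t * d (g t) - L t"
    proof -
      have "AE t in lebesgue. t \<in> {\<sigma>..} \<longrightarrow>
          d t - a t * d (g t) + (LINT s:{h t..t}|lebesgue. kernel_ext K t s * x s) = 0"
        using sol by (auto simp: neutral_solution_def AE_restrict_space_iff d_def)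
      then show ?thesis
      proof eventually_elim
        case (elim t)
        have "L t = (LINT s:{h t..t}|lebesgue. kernel_ext K t s * x s)" if "t \<le> T"
          unfolding L_def by (rule set_lebesgue_integral_cong) (use that in \<open>auto simp: y_x\<close>)
        then show ?case using elim by auto
      qed
    qed
    \<comment> \<open>The bound of \<open>d\<close> fails on a null set, and \<open>g\<close> might
      return to that set on a large set of times; \<open>g_null\<close> excludes this. Arguments
      before \<open>\<sigma>\<close> see the derivative history, bounded by \<open>J\<close>, where
      the weight is at least 1.\<close>
    have dg: "AE t in lebesgue. t \<in> {\<sigma>..T} \<longrightarrow> \<bar>d (g t)\<bar> \<le> \<rho> * (Y + J) * P t"
      if Y: "Y \<ge> 0" and AE: "AE t in lebesgue. t \<in> {\<sigma>..T} \<longrightarrow> \<bar>d t\<bar> \<le> Y * P t" for Y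
    proof -
      obtain N' where N': "N' \<in> null_sets lebesgue" "{t. \<not> (t \<in> {\<sigma>..T} \<longrightarrow> \<bar>d t\<bar> \<le> Y * P t)} \<subseteq> N'"
        using AE unfolding eventually_ae_filter by auto
      have dN': "\<bar>d t\<bar> \<le> Y * P t" if "t \<in> {\<sigma>..T}" "t \<notin> N'" for t
        using N'(2) that by blast
      have "AE t in lebesgue. t \<notin> {t \<in> {0..}. g t \<in> N'}"
        by (rule AE_not_in[OF g_null[OF N'(1)]])
      then show ?thesis
      proof (eventually_elim, intro impI)
        fix t assume tN: "t \<notin> {t \<in> {0..}. g t \<in> N'}" and t: "t \<in> {\<sigma>..T}"
        then have gN: "g t \<notin> N'" and t0: "t \<ge> t0" using t0_nonneg s0 by auto
        have "\<bar>d (g t)\<bar> \<le> (Y + J) * P (g t)"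
        proof (cases "g t < \<sigma>")
          case True
          then have "\<bar>d (g t)\<bar> \<le> J * 1" using \<psi>J by (simp add: d_def deriv_hist_def)
          also have "\<dots> \<le> (Y + J) * P (g t)" by (rule mult_mono) (use True Y J P_ge1 in auto)
          finally show ?thesis .
        next
          case False
          then have "\<bar>d (g t)\<bar> \<le> Y * P (g t)" using gN dN' g_le[OF t0] t by auto
          also have "\<dots> \<le> (Y + J) * P (g t)" by (rule mult_right_mono) (use J P_pos[of "g t"] in auto)
          finally show ?thesis .
        qed
        also have "\<dots> \<le> (Y + J) * (\<rho> * P t)"
          by (rule mult_left_mono[OF P_delay[OF g_delay[OF t0]]]) (use Y J in auto)
        finally show "\<bar>d (g t)\<bar> \<le> \<rho> * (Y + J) * P t" by (simp add: mult_ac)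
      qed
    qed
    have xd: "\<bar>x s\<bar> \<le> X * (\<rho> * P t)"
      if "0 \<le> X" "\<And>s. s \<le> T \<Longrightarrow> \<bar>x s\<bar> \<le> X * P s" "t \<in> {\<sigma>..T}" "h t \<le> s" "s \<le> t" for X s t
    proof -
      have "\<bar>x s\<bar> \<le> X * P s" using that by auto
      also have "\<dots> \<le> X * (\<rho> * P t)"
        by (rule mult_left_mono[OF P_delay]) (use that h_delay[of t] s0 in auto)
      finally show ?thesis .
    qed
    have "\<bar>x T\<bar> \<le> (\<rho> * (\<beta>1 / (\<beta>1 - \<gamma>)) * (A1 + A1') * (\<rho> * (A + Bn) / (1 - \<rho> * A)) +
        4 * (1 + \<rho> * (A1 + A1' + A2 + E))) / (1 - \<kappa>) * J * exp (- \<gamma> * (T - \<sigma>))"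
    proof (rule neutral_small_gain[OF sT dx, where B = B and S = S and ?h0.0 = h0 and ?\<beta>1.0 = \<beta>1
          and ?\<beta>2.0 = \<beta>2 and ?Y1.0 = Y1])
      show "\<bar>x s\<bar> \<le> J" if "s \<le> \<sigma>" for s using \<phi>J x_hist that by simp
      show "AE t in lebesgue. t \<in> {\<sigma>..T} \<longrightarrow> \<bar>d t\<bar> \<le> Y1" using AEd by eventually_elim auto
      show "B integrable_on {\<sigma>..T}" by (rule integrable_on_subinterval[OF B[of T]]) (use s0 in auto)
      show "\<beta>1 \<le> B t \<and> B t \<le> \<beta>2" if "t \<in> {\<sigma>..T}" for t using B_bd s0 that by auto
      show "integral {max \<sigma> (h0 t)..t} B \<le> 1 / exp 1" if "t \<in> {\<sigma>..T}" for t using B_int s0 that by auto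
      show "c \<le> S t" if "t \<in> {\<sigma>..T}" "\<And>s. h0 t \<le> s \<Longrightarrow> s \<le> t \<Longrightarrow> c \<le> x s" for t c
        by (rule S_ge[OF that])
      show "S t \<le> c" if "t \<in> {\<sigma>..T}" "\<And>s. h0 t \<le> s \<Longrightarrow> s \<le> t \<Longrightarrow> x s \<le> c" for t c
        by (rule S_le[OF that])
    next
      fix X Y :: real
      assume X: "0 \<le> X" and Y: "0 \<le> Y" and xX: "\<And>s. s \<le> T \<Longrightarrow> \<bar>x s\<bar> \<le> X * exp (- \<gamma> * (s - \<sigma>))"
        and dY: "AE t in lebesgue. t \<in> {\<sigma>..T} \<longrightarrow> \<bar>d t\<bar> \<le> Y * exp (- \<gamma> * (t - \<sigma>))"
      note xX = xX[folded P_def] and dY = dY[folded P_def]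
      show "AE t in lebesgue. t \<in> {\<sigma>..T} \<longrightarrow> \<bar>d t\<bar> \<le> \<rho> * (A * (Y + J) + Bn * X) * exp (- \<gamma> * (t - \<sigma>))"
        unfolding P_def[symmetric]
        using dg[OF Y dY] eq AE_a AE_b
      proof (eventually_elim, intro impI)
        fix t assume asm: "t \<in> {\<sigma>..T} \<longrightarrow> \<bar>d (g t)\<bar> \<le> \<rho> * (Y + J) * P t"
          "t \<in> {\<sigma>..T} \<longrightarrow> d t = a t * d (g t) - L t" "t0 \<le> t \<longrightarrow> \<bar>a t\<bar> \<le> A" "t0 \<le> t \<longrightarrow> b t \<le> Bn"
          and t: "t \<in> {\<sigma>..T}"
        have t0: "t \<ge> t0" using t s0 by auto
        define Z where "Z = X * (\<rho> * P t)"
        have Z: "Z \<ge> 0" using X \<rho> P_pos[of t] by (simp add: Z_def)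
        have yZ: "\<bar>y s\<bar> \<le> Z" if "s \<in> {h t..t}" for s
          using xd[OF X xX t, of s] that t by (simp add: Z_def y_x)
        have "L t \<le> Z * b t" "- Z * b t \<le> L t"
          unfolding b_eq[OF t0] L_def
          by (rule set_lebesgue_integral_weighted_bounds[OF K_int[OF t0] K_nn[OF t0] y_meas My];
            use yZ in fastforce)+
        then have "\<bar>L t\<bar> \<le> Z * b t" by auto
        also have "\<dots> \<le> Z * Bn" using asm t0 Z by (intro mult_left_mono) auto
        finally have 1: "\<bar>L t\<bar> \<le> Bn * X * \<rho> * P t" by (simp add: Z_def mult_ac)
        have "\<bar>a t * d (g t)\<bar> \<le> A * (\<rho> * (Y + J) * P t)"
          unfolding abs_mult using asm t t0 nn by (intro mult_mono) auto
        then show "\<bar>d t\<bar> \<le> \<rho> * (A * (Y + J) + Bn * X) * P t"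
          using 1 asm t by (simp add: algebra_simps)
      qed
      show "AE t in lebesgue. t \<in> {\<sigma>..T} \<longrightarrow>
          \<bar>d t + B t * S t\<bar> \<le> B t * (\<rho> * ((A1 + A1') * (Y + J) + A2 * X + E * J) * exp (- \<gamma> * (t - \<sigma>)))"
        unfolding P_def[symmetric]
        using dg[OF Y dY] eq AE_aB AE_h AE_bB
      proof (eventually_elim, intro impI)
        fix t assume asm: "t \<in> {\<sigma>..T} \<longrightarrow> \<bar>d (g t)\<bar> \<le> \<rho> * (Y + J) * P t"
          "t \<in> {\<sigma>..T} \<longrightarrow> d t = a t * d (g t) - L t" "t0 \<le> t \<longrightarrow> \<bar>a t\<bar> \<le> A1 * B t"
          "t0 \<le> t \<longrightarrow> b t * (h0 t - h t) \<le> A1' * B t" "t0 \<le> t \<longrightarrow> B t \<le> b t \<and> b t - B t \<le> A2 * B t"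
          and t: "t \<in> {\<sigma>..T}"
        have t0: "t \<ge> t0" using t s0 by auto
        have Bt: "B t > 0" using B_bd[OF t0] \<beta>1 by auto
        have bt: "b t > 0" by (rule b_pos[OF t0])
        define Q where "Q = \<rho> * P t"
        have Q: "Q > 0" using \<rho> P_pos[of t] by (simp add: Q_def)
        have S: "\<bar>S t\<bar> \<le> X * Q"
        proof -
          have x_le: "\<bar>x s\<bar> \<le> X * Q" if "h0 t \<le> s" "s \<le> t" for s
            using xd[OF X xX t, of s] h0[OF t0] that by (auto simp: Q_def)
          have "S t \<le> X * Q" by (rule S_le[OF t]) (use x_le in fastforce)
          moreover have "- (X * Q) \<le> S t" by (rule S_ge[OF t]) (use x_le in fastforce)
          ultimately show ?thesis by auto
        qed
        \<comment> \<open>The shift has length at most \<open>h0 t - h t\<close>. Its part after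
          \<open>\<sigma>\<close> is controlled by the bound of x'; a part before
          \<open>\<sigma>\<close> costs at most \<open>2 * J\<close>, which \<open>Q\<close> can
          absorb because then \<open>1 \<le> P s\<close> and \<open>P s \<le> Q\<close>.\<close>
        have diff: "\<bar>y (max s (h0 t)) - y s\<bar> \<le> (h0 t - h t) * (Y * Q) + 2 * J * Q" if s: "s \<in> {h t..t}" for s
        proof -
          define r where "r = max s (h0 t)"
          have r: "s \<le> r" "r \<le> t" "r - s \<le> h0 t - h t" using s h0[OF t0] by (auto simp: r_def)
          have PQ: "P s \<le> Q" unfolding Q_def by (rule P_delay) (use s h_delay[OF t0] in auto)
          have Lip: "\<bar>x r - x q\<bar> \<le> Y * Q * (r - q)" if q: "\<sigma> \<le> q" "s \<le> q" "q \<le> r" for q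
          proof (rule has_integral_AE_bound[OF dx])
            show "AE v in lebesgue. v \<in> {q..r} \<longrightarrow> \<bar>d v\<bar> \<le> Y * Q"
              using dY
            proof (eventually_elim, intro impI)
              fix v assume "v \<in> {\<sigma>..T} \<longrightarrow> \<bar>d v\<bar> \<le> Y * P v" "v \<in> {q..r}"
              then have "\<bar>d v\<bar> \<le> Y * P v" using q r t by auto
              also have "\<dots> \<le> Y * Q"
                using P_mono[of s v] \<open>v \<in> {q..r}\<close> q PQ Y by (intro mult_left_mono) auto
              finally show "\<bar>d v\<bar> \<le> Y * Q" .
            qed
          qed (use q r t Y Q in auto)
          have JQ: "2 * J \<le> 2 * J * Q" if "s < \<sigma>"
            using mult_left_mono[of 1 Q "2 * J"] P_ge1[of s] that PQ J by auto
          have YQ: "Y * Q * v \<le> (h0 t - h t) * (Y * Q)" if "v \<le> r - s" for v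
            using mult_right_mono[of v "h0 t - h t" "Y * Q"] that r Y Q by (simp add: mult.commute)
          have JQ0: "0 \<le> 2 * J * Q" using J Q by simp
          have "\<bar>x r - x s\<bar> \<le> (h0 t - h t) * (Y * Q) + 2 * J * Q"
          proof (cases "\<sigma> \<le> s")
            case True
            then show ?thesis using Lip[of s] YQ[of "r - s"] r JQ0 by auto
          next
            case s: False
            show ?thesis
            proof (cases "\<sigma> \<le> r")
              case True
              have "\<bar>x \<sigma> - x s\<bar> \<le> 2 * J" using \<phi>J[of \<sigma>] \<phi>J[of s] x_hist s by fastforce
              then show ?thesis using Lip[of \<sigma>] YQ[of "r - \<sigma>"] True s JQ by auto
            next
              case False
              have "\<bar>x r - x s\<bar> \<le> 2 * J" using \<phi>J[of r] \<phi>J[of s] x_hist s False by fastforce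
              then show ?thesis using YQ[of 0] r s JQ by auto
            qed
          qed
          then show ?thesis using r s t by (simp add: y_x r_def)
        qed
        define Z where "Z = (h0 t - h t) * (Y * Q) + 2 * J * Q"
        have "\<bar>b t * S t - L t\<bar> \<le> Z * b t"
        proof -
          let ?D = "\<lambda>s. y (max s (h0 t)) - y s"
          have Dm: "?D \<in> borel_measurable borel" using ym_meas y_meas by measurable
          have DM: "\<bar>?D s\<bar> \<le> 2 * My" for s using My[of s] My[of "max s (h0 t)"] by auto
          have "b t * S t - L t = (LINT s:{h t..t}|lebesgue. kernel_ext K t s * y (max s (h0 t)) - kernel_ext K t s * y s)"
            using bt set_integral_diff(2)[OF S_int[OF t0] L_int[OF t0]] by (simp add: S_def L_def)
          then have "b t * S t - L t = (LINT s:{h t..t}|lebesgue. kernel_ext K t s * ?D s)"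
            by (simp add: right_diff_distrib)
          moreover have "(LINT s:{h t..t}|lebesgue. kernel_ext K t s * ?D s) \<le> Z * b t"
            "- Z * b t \<le> (LINT s:{h t..t}|lebesgue. kernel_ext K t s * ?D s)"
            unfolding b_eq[OF t0]
            by (rule set_lebesgue_integral_weighted_bounds[OF K_int[OF t0] K_nn[OF t0] Dm DM];
              use diff[folded Z_def] in fastforce)+
          ultimately show ?thesis by auto
        qed
        also have "Z * b t = (b t * (h0 t - h t)) * (Y * Q) + (2 * J * Q) * b t"
          by (simp add: Z_def algebra_simps)
        also have "\<dots> \<le> (A1' * B t) * (Y * Q) + (2 * J * Q) * ((1 + A2) * B t)"
          using asm t0 Y Q J by (intro add_mono mult_right_mono mult_left_mono) (auto simp: algebra_simps)
        finally have 1: "\<bar>b t * S t - L t\<bar> \<le> B t * (Q * (A1' * Y + E * J))"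
          by (simp add: E_def algebra_simps)
        have "\<bar>(b t - B t) * S t\<bar> \<le> (A2 * B t) * (X * Q)"
          unfolding abs_mult using asm t0 S by (intro mult_mono) auto
        then have 2: "\<bar>(b t - B t) * S t\<bar> \<le> B t * (Q * (A2 * X))" by (simp add: mult_ac)
        have "\<bar>a t * d (g t)\<bar> \<le> (A1 * B t) * (\<rho> * (Y + J) * P t)"
          unfolding abs_mult using asm t t0 nn Bt by (intro mult_mono) auto
        then have 3: "\<bar>a t * d (g t)\<bar> \<le> B t * (Q * (A1 * (Y + J)))" by (simp add: Q_def mult_ac)
        \<comment> \<open>The three summands are the neutral term, the truncation error and the
          error of replacing \<open>b\<close> by \<open>B\<close>, matching \<open>A1\<close>,
          \<open>A1'\<close> and \<open>A2\<close>.\<close>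
        have "d t + B t * S t = a t * d (g t) + (b t * S t - L t) - (b t - B t) * S t"
          using asm t by (simp add: algebra_simps)
        then have "\<bar>d t + B t * S t\<bar> \<le> B t * (Q * (A1 * (Y + J))) + B t * (Q * (A1' * Y + E * J)) + B t * (Q * (A2 * X))"
          using 1 2 3 by linarith
        also have "\<dots> = B t * (Q * (A1 * (Y + J) + A1' * Y + A2 * X + E * J))" by (simp add: algebra_simps)
        also have "\<dots> \<le> B t * (Q * ((A1 + A1') * (Y + J) + A2 * X + E * J))"
          using Bt Q nn J by (intro mult_left_mono) (auto simp: algebra_simps)
        finally show "\<bar>d t + B t * S t\<bar> \<le> B t * (\<rho> * ((A1 + A1') * (Y + J) + A2 * X + E * J) * P t)"
          by (simp add: Q_def mult_ac)
      qed
    qed (use nn \<gamma> \<rho> \<beta>1 in \<open>auto simp: \<kappa>_def \<rho>_def E_def\<close>)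
    then show ?thesis by (simp add: M_def)
  qed
  show ?thesis
    unfolding exponentially_stable_def
  \<comment> \<open>The constant \<open>\<bar>M\<bar> + 1\<close> is positive without any discussion
    of the sign of \<open>M\<close>.\<close>
  proof (rule exI[of _ "\<bar>M\<bar> + 1"], rule conjI, simp,
      rule exI[of _ \<gamma>], rule conjI[OF \<gamma>(1)], intro allI impI)
    fix \<sigma> \<phi> \<psi> x t
    assume s0: "t0 \<le> \<sigma>" and init: "initial_data \<sigma> \<phi> \<psi>" and sol: "neutral_solution a g h K \<sigma> \<phi> \<psi> x"
      and t: "\<sigma> \<le> t"
    let ?f = "\<lambda>s. \<bar>\<phi> s\<bar> + \<bar>if s < \<sigma> then \<psi> s else 0\<bar>"
    define J where "J = (SUP s\<in>{..\<sigma>}. ?f s)"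
    have "bdd_above (?f ` {..\<sigma>})"
    proof -
      obtain c1 c2 where "\<forall>s\<in>{..\<sigma>}. \<bar>\<phi> s\<bar> \<le> c1" "\<forall>s\<in>{..<\<sigma>}. \<bar>\<psi> s\<bar> \<le> c2"
        using init unfolding initial_data_def bounded_iff by auto
      then have "?f s \<le> c1 + \<bar>c2\<bar>" if "s \<in> {..\<sigma>}" for s
        using that by (cases "s < \<sigma>") (force dest: bspec[of _ _ s])+
      then show ?thesis by (auto intro!: bdd_aboveI[of _ "c1 + \<bar>c2\<bar>"])
    qed
    then have fJ: "?f s \<le> J" if "s \<le> \<sigma>" for s
      unfolding J_def by (rule cSUP_upper[rotated]) (use that in simp)
    have "\<bar>x t\<bar> \<le> M * J * exp (- \<gamma> * (t - \<sigma>))"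
    proof (rule main[OF s0 t init sol])
      show "\<bar>\<phi> s\<bar> \<le> J" if "s \<le> \<sigma>" for s using fJ[OF that] by auto
      show "\<bar>\<psi> s\<bar> \<le> J" if "s < \<sigma>" for s using fJ[of s] that by auto
    qed
    also have "\<dots> \<le> (\<bar>M\<bar> + 1) * J * exp (- \<gamma> * (t - \<sigma>))"
      using fJ[of \<sigma>] by (intro mult_right_mono) auto
    finally show "\<bar>x t\<bar> \<le> (\<bar>M\<bar> + 1) * exp (- \<gamma> * (t - \<sigma>)) * (SUP s\<in>{..\<sigma>}. ?f s)"
      by (simp add: J_def mult_ac)
  qed
qed

section \<open>Essential norms on a half-line\<close>

text \<open>A half-line is not a null set, so contradictory bounds cannot hold almost everywhere on
  it. This gives nonnegativity of \<open>ess_norm\<close> and later positivity of the norm of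
  \<open>b\<close>.\<close>

lemma not_AE_not_ge: "\<not> (AE t in lebesgue. \<not> t \<ge> (t0::real))"
proof
  assume "AE t in lebesgue. \<not> t \<ge> t0"
  then have "{t0..t0 + 1} \<in> null_sets lebesgue"
    by (subst AE_iff_null_sets) (auto elim!: eventually_mono)
  then have "emeasure lebesgue {t0..t0 + 1} = 0" by (rule null_setsD1)
  then show False by simp
qed

lemma ess_norm_AE: "AE t in lebesgue. t \<ge> t0 \<longrightarrow> ereal \<bar>f t\<bar> \<le> ess_norm t0 f"
  using esssup_AE[of "\<lambda>t. ereal \<bar>f t\<bar>" "lebesgue_on {t0..}"]
  by (subst (asm) AE_restrict_space_iff) (auto simp: ess_norm_def)

lemma ess_norm_nonneg: "0 \<le> ess_norm t0 f"
proof (rule ccontr)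
  assume "\<not> 0 \<le> ess_norm t0 f"
  then have "AE t in lebesgue. \<not> t \<ge> t0"
    using ess_norm_AE[of t0 f]
    by (auto elim!: eventually_mono dest: order_trans[OF abs_ge_zero[THEN ereal_less_eq(5)[THEN iffD2]]])
  with not_AE_not_ge show False by blast
qed

text \<open>Measurability is a consequence of finiteness, since \<open>esssup\<close> of a
  non-measurable function is infinite. It is obtained for the absolute value only, as that is the
  function inside \<open>ess_norm\<close>.\<close>

lemma ess_norm_finiteE:
  assumes "ess_norm t0 f < \<infinity>"
  obtains c where "ess_norm t0 f = ereal c" "c \<ge> 0" "AE t in lebesgue. t \<ge> t0 \<longrightarrow> \<bar>f t\<bar> \<le> c"
    "(\<lambda>t. \<bar>f t\<bar>) \<in> borel_measurable (lebesgue_on {t0..})"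
proof -
  obtain c where c: "ess_norm t0 f = ereal c" "c \<ge> 0"
    using assms ess_norm_nonneg[of t0 f] by (cases "ess_norm t0 f") auto
  moreover have "(\<lambda>t. ereal \<bar>f t\<bar>) \<in> borel_measurable (lebesgue_on {t0..})"
    using assms esssup_non_measurable[of "\<lambda>t. ereal \<bar>f t\<bar>" "lebesgue_on {t0..}"]
    by (auto simp: ess_norm_def top_ereal_def)
  ultimately show thesis
    using that[of c] ess_norm_AE[of t0 f] by simp
qed

lemma ess_norm_leI:
  assumes "(\<lambda>t. \<bar>f t\<bar>) \<in> borel_measurable (lebesgue_on {t0..})"
    and "AE t in lebesgue. t \<ge> t0 \<longrightarrow> \<bar>f t\<bar> \<le> c"
  shows "ess_norm t0 f \<le> ereal c"
  unfolding ess_norm_def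
proof (rule esssup_I)
  show "(\<lambda>t. ereal \<bar>f t\<bar>) \<in> borel_measurable (lebesgue_on {t0..})" using assms(1) by simp
  show "AE t in lebesgue_on {t0..}. ereal \<bar>f t\<bar> \<le> ereal c"
    using assms(2) by (subst AE_restrict_space_iff) auto
qed

text \<open>Extracts finiteness of the norms from a smallness condition. The factor \<open>k\<close>
  must be positive because infinity times 0 is 0 in \<open>ereal\<close>.\<close>

lemma ereal_mult_add_less_one:
  fixes x y :: ereal
  assumes "x * ereal k + y < 1" "0 < k" "0 \<le> x" "0 \<le> y"
  shows "x < \<infinity>" "y < \<infinity>"
  using assms by (cases x; cases y; auto)+

lemma set_integrable_AE_bounded:
  fixes f :: "real \<Rightarrow> real"
  assumes "f \<in> borel_measurable lebesgue" "AE t in lebesgue. \<bar>f t\<bar> \<le> c"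
  shows "set_integrable lebesgue {p..q} f"
  unfolding set_integrable_def
proof (rule Bochner_Integration.integrable_bound)
  show "integrable lebesgue (\<lambda>t. c * indicator {p..q} t)"
    by (intro integrable_mult_right integrable_real_indicator) (auto simp: emeasure_lborel_Icc_eq)
  show "AE t in lebesgue. norm (indicator {p..q} t *\<^sub>R f t) \<le> norm (c * indicator {p..q} t)"
    using assms(2) by eventually_elim (auto simp: indicator_def)
  show "(\<lambda>t. indicator {p..q} t *\<^sub>R f t) \<in> borel_measurable lebesgue"
    by (intro borel_measurable_scaleR borel_measurable_indicator assms(1)) simp
qed

section \<open>The three conditions as choices of coefficient and delay\<close>

theorem theorem5p11:
  fixes t0 a0 \<beta> \<delta> \<tau> :: real
    and a g h b b0 :: "real \<Rightarrow> real"
    and K :: "real \<Rightarrow> real \<Rightarrow> real"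
  assumes t0_nonneg: "t0 \<ge> 0"
    and a_meas: "a \<in> borel_measurable (lebesgue_on {0..})"
    and g_meas: "g \<in> borel_measurable (lebesgue_on {0..})"
    and h_meas: "h \<in> borel_measurable (lebesgue_on {0..})"
    and K_nonneg: "\<And>t s. t \<ge> 0 \<Longrightarrow> s \<ge> 0 \<Longrightarrow> K t s \<ge> 0"
    and K_meas: "(\<lambda>(t, s). K t s) \<in> borel_measurable (lebesgue_on ({0..} \<times> {0..}))"
    and K_locint: "\<And>C. compact C \<Longrightarrow> C \<subseteq> {0..} \<times> {0..} \<Longrightarrow>
          (\<lambda>(t, s). K t s) absolutely_integrable_on C"
    and b_eq: "b = kernel_mass K h"
    and a_bdd: "ess_norm 0 a < \<infinity>"
    and b_bdd: "ess_norm 0 b < \<infinity>"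
    and a0_less: "a0 < 1"
    and a_le: "\<And>t. t \<ge> t0 \<Longrightarrow> \<bar>a t\<bar> \<le> a0"
    and \<beta>_pos: "\<beta> > 0"
    and b_ge: "\<And>t. t \<ge> t0 \<Longrightarrow> b t \<ge> \<beta>"
    and g_le: "\<And>t. t \<ge> 0 \<Longrightarrow> g t \<le> t"
    and h_le: "\<And>t. t \<ge> 0 \<Longrightarrow> h t \<le> t"
    and g_lim: "filterlim g at_top at_top"
    and h_lim: "filterlim h at_top at_top"
    and g_null: "\<And>E. E \<in> null_sets lebesgue \<Longrightarrow> {t \<in> {0..}. g t \<in> E} \<in> null_sets lebesgue"
    and \<delta>_pos: "\<delta> > 0"
    and \<tau>_pos: "\<tau> > 0"
    and g_delay: "\<And>t. t \<ge> t0 \<Longrightarrow> t - g t \<le> \<delta>"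
    and h_delay: "\<And>t. t \<ge> t0 \<Longrightarrow> t - h t \<le> \<tau>"
    and b0_eq: "b0 = (\<lambda>t. min (b t) (1 / (\<tau> * exp 1)))"
    and conditions:
      "((\<forall>t\<ge>t0. (LINT s:{h t..t}|lebesgue. b s) \<le> 1 / exp 1) \<and>
          ess_norm t0 a + ess_norm t0 b * ess_norm t0 (\<lambda>t. a t / b t) < 1)
       \<or> ess_norm t0 (\<lambda>t. a t / b0 t) * (ess_norm t0 b / (1 - ess_norm t0 a))
            + ess_norm t0 (\<lambda>t. (b t - b0 t) / b0 t) < 1
       \<or> ess_norm t0 b *
            (ess_norm t0 (\<lambda>t. a t / b t)
             + ess_norm t0 (\<lambda>t. max (t - h t - 1 / (real_of_ereal (ess_norm t0 b) * exp 1)) 0))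
          < 1 - ess_norm t0 a"
  shows "exponentially_stable t0 a g h K"
proof -
  obtain an where an: "ess_norm t0 a = ereal an" "an \<ge> 0"
    and an_AE: "AE t in lebesgue. t \<ge> t0 \<longrightarrow> \<bar>a t\<bar> \<le> an" and "an < 1"
  proof -
    have "a \<in> borel_measurable (lebesgue_on {t0..})"
      by (rule measurable_restrict_mono[OF a_meas]) (use t0_nonneg in auto)
    then have le: "ess_norm t0 a \<le> ereal a0"
      by (intro ess_norm_leI) (use a_le in auto)
    then have "ess_norm t0 a < \<infinity>" by (cases "ess_norm t0 a") auto
    then show thesis
      by (rule ess_norm_finiteE) (use le a0_less that in auto)
  qed
  have b_nonneg: "b t \<ge> 0" for t
    unfolding b_eq kernel_mass_def set_lebesgue_integral_def
    using K_nonneg by (auto intro!: Bochner_Integration.integral_nonneg simp: kernel_ext_def)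
  have b_neg: "b t = 0" if "t < 0" for t using that by (simp add: b_eq kernel_mass_def)
  obtain bb where bb: "AE t in lebesgue. t \<ge> 0 \<longrightarrow> \<bar>b t\<bar> \<le> bb" "bb \<ge> 0"
    and b_meas0: "(\<lambda>t. \<bar>b t\<bar>) \<in> borel_measurable (lebesgue_on {0..})"
    using ess_norm_finiteE[OF b_bdd] by metis
  \<comment> \<open>The finite norm makes only the absolute value measurable, and only on the
    half-line. As \<open>b\<close> is nonnegative and vanishes at negative arguments by convention,
    this is \<open>b\<close> on the whole line.\<close>
  have b_meas: "b \<in> borel_measurable lebesgue"
  proof -
    have "(\<lambda>t. if t \<in> {0..} then \<bar>b t\<bar> else 0) \<in> borel_measurable lebesgue"
      using b_meas0 by (subst (asm) borel_measurable_if[symmetric]) auto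
    moreover have "(\<lambda>t. if t \<in> {0..} then \<bar>b t\<bar> else 0) = b"
      using b_nonneg b_neg by (auto simp: fun_eq_iff not_le)
    ultimately show ?thesis by simp
  qed
  have b_AE: "AE t in lebesgue. \<bar>b t\<bar> \<le> bb"
    using bb(1) by eventually_elim (use b_neg bb(2) in \<open>auto simp: not_le\<close>)
  obtain bn where bn: "ess_norm t0 b = ereal bn"
    and bn_AE: "AE t in lebesgue. t \<ge> t0 \<longrightarrow> \<bar>b t\<bar> \<le> bn"
  proof -
    have "(\<lambda>t. \<bar>b t\<bar>) \<in> borel_measurable (lebesgue_on {t0..})"
      by (rule measurable_restrict_mono[OF b_meas0]) (use t0_nonneg in auto)
    then have le: "ess_norm t0 b \<le> ereal bb"
      by (intro ess_norm_leI) (use b_AE in \<open>auto elim: eventually_mono\<close>)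
    then have "ess_norm t0 b < \<infinity>" by (cases "ess_norm t0 b") auto
    then show thesis
      by (rule ess_norm_finiteE) (use that in auto)
  qed
  have bn_pos: "bn > 0"
  proof (rule ccontr)
    assume "\<not> bn > 0"
    then have "AE t in lebesgue. \<not> t \<ge> t0"
      using bn_AE by (auto elim!: eventually_mono dest!: b_ge) (use \<beta>_pos in linarith)
    with not_AE_not_ge show False by blast
  qed
  have b_AE_le: "AE t in lebesgue. t \<ge> t0 \<longrightarrow> b t \<le> bn"
    using bn_AE by eventually_elim auto
  have b_pos: "b t > 0" if "t \<ge> t0" for t using b_ge[OF that] \<beta>_pos by simp
  have reduction: "exponentially_stable t0 a g h K"
    if h0: "\<And>t. t \<ge> t0 \<Longrightarrow> h t \<le> h0 t \<and> h0 t \<le> t"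
      and B_bd: "\<And>t. t \<ge> t0 \<Longrightarrow> \<beta>1 \<le> B t \<and> B t \<le> \<beta>2" and \<beta>1: "\<beta>1 > 0"
      and B: "\<And>p q. B integrable_on {p..q}"
      and B_int: "\<And>\<sigma> t. t0 \<le> \<sigma> \<Longrightarrow> \<sigma> \<le> t \<Longrightarrow> integral {max \<sigma> (h0 t)..t} B \<le> 1 / exp 1"
      and "AE t in lebesgue. t \<ge> t0 \<longrightarrow> \<bar>a t\<bar> \<le> A1 * B t"
      and "AE t in lebesgue. t \<ge> t0 \<longrightarrow> b t * (h0 t - h t) \<le> A1' * B t"
      and "AE t in lebesgue. t \<ge> t0 \<longrightarrow> B t \<le> b t \<and> b t - B t \<le> A2 * B t"
      and "A1 \<ge> 0" "A1' \<ge> 0" "A2 \<ge> 0" "(A1 + A1') * (bn / (1 - an)) + A2 < 1"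
    for h0 B \<beta>1 \<beta>2 A1 A1' A2
  proof (rule neutral_exponentially_stable[where b = b and B = B and ?h0.0 = h0 and \<Delta> = "max \<delta> \<tau>"
        and ?\<beta>1.0 = \<beta>1 and ?\<beta>2.0 = \<beta>2 and A = an and Bn = bn and ?A1.0 = A1 and A1' = A1' and ?A2.0 = A2])
    show "b t = (LINT s:{h t..t}|lebesgue. kernel_ext K t s)" if "t \<ge> t0" for t
      using that t0_nonneg by (simp add: b_eq kernel_mass_def)
    show "t - g t \<le> max \<delta> \<tau>" "t - h t \<le> max \<delta> \<tau>" if "t \<ge> t0" for t
      using g_delay[OF that] h_delay[OF that] by auto
  qed (use that t0_nonneg K_nonneg b_pos g_le g_null an_AE b_AE_le an(2) bn_pos \<open>an < 1\<close> in auto)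
  have integral_le_length: "integral {p..t} B \<le> 1 / exp 1"
    if "B integrable_on {p..t}" "\<And>s. s \<in> {p..t} \<Longrightarrow> B s \<le> c" "p \<le> t" "c > 0" "t - p \<le> 1 / (c * exp 1)"
    for B :: "real \<Rightarrow> real" and p t c
  proof -
    have "integral {p..t} B \<le> integral {p..t} (\<lambda>_. c)"
      by (rule integral_le) (use that in auto)
    also have "\<dots> = c * (t - p)" using that by simp
    also have "\<dots> \<le> c * (1 / (c * exp 1))" using that by (intro mult_left_mono) auto
    finally show ?thesis using that by simp
  qed
  \<comment> \<open>The comparison coefficient must be bounded at every point, while the norm bounds
    \<open>b\<close> almost everywhere; the cut at \<open>bn\<close> changes \<open>b\<close> on
    \<open>[t0, \<infinity>)\<close> only in a null set.\<close>
  define b1 where "b1 = (\<lambda>t. min (b t) bn)"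
  have b1_int: "b1 integrable_on {p..q}" for p q
  proof -
    have "set_integrable lebesgue {p..q} b1"
    proof (rule set_integrable_AE_bounded[where c = bn])
      show "b1 \<in> borel_measurable lebesgue" unfolding b1_def using b_meas by measurable
      have "\<bar>b1 t\<bar> \<le> bn" for t using b_nonneg[of t] bn_pos by (auto simp: b1_def)
      then show "AE t in lebesgue. \<bar>b1 t\<bar> \<le> bn" by simp
    qed
    then show ?thesis by (rule set_lebesgue_integral_eq_integral)
  qed
  have b1_bd: "min \<beta> bn \<le> b1 t \<and> b1 t \<le> bn" if "t \<ge> t0" for t
    using b_ge[OF that] by (auto simp: b1_def)
  have b1_AE: "AE t in lebesgue. t \<ge> t0 \<longrightarrow> b1 t = b t"
    using b_AE_le by eventually_elim (auto simp: b1_def)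
  have b1_bb: "AE t in lebesgue. t \<ge> t0 \<longrightarrow> b1 t \<le> b t \<and> b t - b1 t \<le> 0 * b1 t"
    using b1_AE by eventually_elim auto
  have a_b1: "AE t in lebesgue. t \<ge> t0 \<longrightarrow> \<bar>a t\<bar> \<le> q * b1 t"
    if "AE t in lebesgue. t \<ge> t0 \<longrightarrow> \<bar>a t / b t\<bar> \<le> q" for q
    using that b1_AE
  proof eventually_elim
    case (elim t)
    then show ?case using b_pos[of t] by (auto simp: abs_divide pos_divide_le_eq)
  qed
  consider
      (i) "\<forall>t\<ge>t0. (LINT s:{h t..t}|lebesgue. b s) \<le> 1 / exp 1"
        "ess_norm t0 a + ess_norm t0 b * ess_norm t0 (\<lambda>t. a t / b t) < 1"
    | (ii) "ess_norm t0 (\<lambda>t. a t / b0 t) * (ess_norm t0 b / (1 - ess_norm t0 a))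
            + ess_norm t0 (\<lambda>t. (b t - b0 t) / b0 t) < 1"
    | (iii) "ess_norm t0 b *
            (ess_norm t0 (\<lambda>t. a t / b t)
             + ess_norm t0 (\<lambda>t. max (t - h t - 1 / (real_of_ereal (ess_norm t0 b) * exp 1)) 0))
          < 1 - ess_norm t0 a"
    using conditions by blast
  then show ?thesis
  proof cases
    case i
    have "ess_norm t0 (\<lambda>t. a t / b t) < \<infinity>"
      using i(2) bn_pos an bn by (cases "ess_norm t0 (\<lambda>t. a t / b t)") auto
    then obtain q where q: "ess_norm t0 (\<lambda>t. a t / b t) = ereal q" "q \<ge> 0"
      and q_AE: "AE t in lebesgue. t \<ge> t0 \<longrightarrow> \<bar>a t / b t\<bar> \<le> q"
      by (rule ess_norm_finiteE)
    have "an + bn * q < 1" using i(2) by (simp add: an bn q one_ereal_def)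
    show ?thesis
    \<comment> \<open>There is neither truncation nor a change of coefficient up to null sets, so
      the loop gain is \<open>q * (bn / (1 - an))\<close>, which is below 1 exactly when
      \<open>an + bn * q < 1\<close>.\<close>
    proof (rule reduction[of h "min \<beta> bn" b1 bn q 0 0])
      fix \<sigma> t assume st: "t0 \<le> \<sigma>" "\<sigma> \<le> t"
      then have t: "t \<ge> t0" "t \<ge> 0" using t0_nonneg by auto
      have b_int: "set_integrable lebesgue {p..q} b" for p q
        by (rule set_integrable_AE_bounded[OF b_meas b_AE])
      note b_HK = set_lebesgue_integral_eq_integral[OF b_int]
      have "integral {max \<sigma> (h t)..t} b1 \<le> integral {max \<sigma> (h t)..t} b"
        by (rule integral_le[OF b1_int b_HK(1)]) (simp add: b1_def)
      also have "\<dots> \<le> integral {h t..t} b"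
        by (rule integral_subset_le) (use b_HK(1) b_nonneg in auto)
      also have "\<dots> \<le> 1 / exp 1" using i(1) t b_HK(2) by metis
      finally show "integral {max \<sigma> (h t)..t} b1 \<le> 1 / exp 1" .
    qed (use h_le t0_nonneg b1_bd bn_pos \<beta>_pos b1_int a_b1[OF q_AE] q b1_bb \<open>an < 1\<close>
        \<open>an + bn * q < 1\<close> in \<open>auto simp: pos_divide_less_eq mult.commute\<close>)
  next
    case ii
    have bn': "ess_norm t0 b / (1 - ess_norm t0 a) = ereal (bn / (1 - an))" "bn / (1 - an) > 0"
      using \<open>an < 1\<close> bn_pos by (simp_all add: an bn one_ereal_def)
    note fin = ereal_mult_add_less_one[OF ii[unfolded bn'(1)] bn'(2) ess_norm_nonneg ess_norm_nonneg]
    obtain q where q: "ess_norm t0 (\<lambda>t. a t / b0 t) = ereal q" "q \<ge> 0"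
      and q_AE: "AE t in lebesgue. t \<ge> t0 \<longrightarrow> \<bar>a t / b0 t\<bar> \<le> q"
      by (rule ess_norm_finiteE[OF fin(1)])
    obtain r where r: "ess_norm t0 (\<lambda>t. (b t - b0 t) / b0 t) = ereal r" "r \<ge> 0"
      and r_AE: "AE t in lebesgue. t \<ge> t0 \<longrightarrow> \<bar>(b t - b0 t) / b0 t\<bar> \<le> r"
      by (rule ess_norm_finiteE[OF fin(2)])
    have small: "q * (bn / (1 - an)) + r < 1" using ii[unfolded bn'(1) q(1) r(1)] by simp
    have \<tau>e: "1 / (\<tau> * exp 1) > 0" using \<tau>_pos by simp
    have b0_pos: "b0 t > 0" if "t \<ge> t0" for t using b_pos[OF that] \<tau>e by (simp add: b0_eq)
    have b0_int: "b0 integrable_on {p..q}" for p q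
    proof -
      have "set_integrable lebesgue {p..q} b0"
      proof (rule set_integrable_AE_bounded)
        show "b0 \<in> borel_measurable lebesgue" unfolding b0_eq using b_meas by measurable
        have "\<bar>b0 t\<bar> \<le> 1 / (\<tau> * exp 1)" for t using b_nonneg[of t] \<tau>e by (auto simp: b0_eq)
        then show "AE t in lebesgue. \<bar>b0 t\<bar> \<le> 1 / (\<tau> * exp 1)" by simp
      qed
      then show ?thesis by (rule set_lebesgue_integral_eq_integral)
    qed
    show ?thesis
    \<comment> \<open>The delay is at most \<open>\<tau>\<close> and \<open>b0\<close> is cut at
      \<open>1 / (\<tau> * exp 1)\<close>, so the integral condition holds without truncating the
      delay; the price is the coefficient error \<open>r\<close>.\<close>
    proof (rule reduction[of h "min \<beta> (1 / (\<tau> * exp 1))" b0 "1 / (\<tau> * exp 1)" q 0 r])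
      fix \<sigma> t assume st: "t0 \<le> \<sigma>" "\<sigma> \<le> t"
      show "integral {max \<sigma> (h t)..t} b0 \<le> 1 / exp 1"
      proof (rule integral_le_length[where c = "1 / (\<tau> * exp 1)"])
        have "t - max \<sigma> (h t) \<le> \<tau>" using h_delay[of t] st by auto
        then show "t - max \<sigma> (h t) \<le> 1 / (1 / (\<tau> * exp 1) * exp 1)" by simp
      qed (use b0_int h_le[of t] st t0_nonneg \<tau>e in \<open>auto simp: b0_eq\<close>)
    next
      show "AE t in lebesgue. t \<ge> t0 \<longrightarrow> \<bar>a t\<bar> \<le> q * b0 t"
        using q_AE
      proof eventually_elim
        case (elim t)
        then show ?case using b0_pos[of t] by (auto simp: abs_divide pos_divide_le_eq)
      qed
      show "AE t in lebesgue. t \<ge> t0 \<longrightarrow> b0 t \<le> b t \<and> b t - b0 t \<le> r * b0 t"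
        using r_AE
      proof eventually_elim
        case (elim t)
        show ?case
        proof
          assume t: "t \<ge> t0"
          have "(b t - b0 t) / b0 t \<le> r"
            using elim t order_trans[OF abs_ge_self, of "(b t - b0 t) / b0 t" r] by simp
          then show "b0 t \<le> b t \<and> b t - b0 t \<le> r * b0 t"
            using b0_pos[OF t] by (simp add: pos_divide_le_eq) (simp add: b0_eq)
        qed
      qed
    qed (use h_le t0_nonneg b_ge \<tau>e \<beta>_pos b0_int q r small in \<open>auto simp: b0_eq min_le_iff_disj\<close>)
  next
    case iii
    let ?s = "\<lambda>t. max (t - h t - 1 / (real_of_ereal (ess_norm t0 b) * exp 1)) 0"
    have "ess_norm t0 (\<lambda>t. a t / b t) < \<infinity>" "ess_norm t0 ?s < \<infinity>"
      using iii bn_pos an(1) ess_norm_nonneg[of t0 "\<lambda>t. a t / b t"] ess_norm_nonneg[of t0 ?s]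
      by (cases "ess_norm t0 (\<lambda>t. a t / b t)"; cases "ess_norm t0 ?s"; auto simp: bn one_ereal_def)+
    then obtain q r where q: "ess_norm t0 (\<lambda>t. a t / b t) = ereal q" "q \<ge> 0"
      and q_AE: "AE t in lebesgue. t \<ge> t0 \<longrightarrow> \<bar>a t / b t\<bar> \<le> q"
      and r: "ess_norm t0 ?s = ereal r" "r \<ge> 0"
      and r_AE: "AE t in lebesgue. t \<ge> t0 \<longrightarrow> \<bar>?s t\<bar> \<le> r"
      by (elim ess_norm_finiteE)
    have "bn * (q + r) < 1 - an" using iii unfolding q r by (simp add: an bn one_ereal_def)
    \<comment> \<open>A delay of at most \<open>1 / (bn * exp 1)\<close> keeps the integral of a
      coefficient bounded by \<open>bn\<close> below 1/e. The removed length
      \<open>h0 t - h t\<close> is exactly the positive part whose norm \<open>r\<close> occurs in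
      the condition.\<close>
    define h0 where "h0 t = max (h t) (t - 1 / (bn * exp 1))" for t
    have be: "1 / (bn * exp 1) > 0" using bn_pos by simp
    show ?thesis
    proof (rule reduction[of h0 "min \<beta> bn" b1 bn q r 0])
      fix \<sigma> t assume st: "t0 \<le> \<sigma>" "\<sigma> \<le> t"
      show "integral {max \<sigma> (h0 t)..t} b1 \<le> 1 / exp 1"
        by (rule integral_le_length[where c = bn])
          (use b1_int h_le[of t] st t0_nonneg be bn_pos in \<open>auto simp: h0_def b1_def\<close>)
    next
      show "AE t in lebesgue. t \<ge> t0 \<longrightarrow> b t * (h0 t - h t) \<le> r * b1 t"
        using r_AE b1_AE
      proof eventually_elim
        case (elim t)
        show ?case
        proof
          assume t: "t \<ge> t0"
          have "h0 t - h t \<le> r" using elim t by (auto simp: h0_def bn)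
          then have "b t * (h0 t - h t) \<le> b t * r" using b_pos[OF t] by (intro mult_left_mono) auto
          then show "b t * (h0 t - h t) \<le> r * b1 t" using elim t by (simp add: mult.commute)
        qed
      qed
    qed (use h_le t0_nonneg b1_bd bn_pos \<beta>_pos b1_int a_b1[OF q_AE] q r b1_bb \<open>an < 1\<close> be
        \<open>bn * (q + r) < 1 - an\<close> in \<open>auto simp: pos_divide_less_eq mult.commute h0_def\<close>)
  qed
qed

end
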